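(* Let $F_4$ be the group of $\mathbf R$-linear automorphisms of the exceptional Jordan algebra $\mathfrak J$, let $\sigma,\gamma\in F_4$ be the two commuting involutions defined in the context, and let $(F_4)^{\sigma,\gamma}=\{\alpha\in F_4 : \sigma\alpha=\alpha\sigma,\ \gamma\alpha=\alpha\gamma\}$. Then $$(F_4)^{\sigma,\gamma}\cong (Sp(1)\times Sp(1)\times Sp(2))/\mathbf Z_2,\qquad \mathbf Z_2=\{(1,1,E),(-1,-1,-E)\}.$$
   Context: Let $\mathbf H$ be the quaternions and $\mathfrak C=\mathbf H\oplus\mathbf He_4$ the Cayley (division octonion) algebra with product $(m+ae_4)(n+be_4)=(mn-\bar ba)+(a\bar n+bm)e_4$ and conjugation $\overline{m+ae_4}=\bar m-ae_4$. Let $\mathfrak J=\{X\in M(3,\mathfrak C): X^*=X\}$ with Jordan product $X\circ Y=\tfrac12(XY+YX)$; write $X=\begin{pmatrix}\xi_1&x_3&\bar x_2\\ \bar x_3&\xi_2&x_1\\ x_2&\bar x_1&\xi_3\end{pmatrix}$ with $\xi_k\in\mathbf R$, $x_k\in\mathfrak C$. Define $F_4=\{\alpha\in \mathrm{Iso}_{\mathbf R}(\mathfrak J): \alpha(X\circ Y)=\alpha X\circ\alpha Y\}$. The map $\sigma$ replaces $(x_1,x_2,x_3)$ by $(x_1,-x_2,-x_3)$ and fixes the $\xi_k$; the map $\gamma$ fixes the $\xi_k$ and replaces each $x_k=m_k+a_ke_4$ ($m_k,a_k\in\mathbf H$) by $m_k-a_ke_4$. Both lie in $F_4$. $Sp(n)$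 is the group of quaternionic unitary $n\times n$ matrices and $E$ is the identity matrix. $\cong$ denotes isomorphism of (Lie) groups. *)

theory Defs
  imports "HOL-Analysis.Analysis" "HOL-Algebra.Bij" "HOL-Algebra.Coset"
begin

section \<open>Quaternions\<close>

datatype quat = Quat (qre: real) (qi: real) (qj: real) (qk: real)

lemma quat_eq_iff:
  "x = y \<longleftrightarrow> qre x = qre y \<and> qi x = qi y \<and> qj x = qj y \<and> qk x = qk y"
  by (cases x; cases y) auto

instantiation quat :: ring_1
begin

definition "0 = Quat 0 0 0 0"
definition "1 = Quat 1 0 0 0"
definition "x + y = Quat (qre x + qre y) (qi x + qi y) (qj x + qj y) (qk x + qk y)"
definition "- x = Quat (- qre x) (- qi x) (- qj x) (- qk x)"
definition "x - y = Quat (qre x - qre y) (qi x - qi y) (qj x - qj y) (qk x - qk y)"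
definition "x * y = Quat
  (qre x * qre y - qi x * qi y - qj x * qj y - qk x * qk y)
  (qre x * qi y + qi x * qre y + qj x * qk y - qk x * qj y)
  (qre x * qj y - qi x * qk y + qj x * qre y + qk x * qi y)
  (qre x * qk y + qi x * qj y - qj x * qi y + qk x * qre y)"

lemmas quat_ops = zero_quat_def one_quat_def plus_quat_def uminus_quat_def
  minus_quat_def times_quat_def

instance
  by standard (auto simp: quat_ops algebra_simps)

end

instantiation quat :: real_algebra_1
begin

definition "r *\<^sub>R x = Quat (r * qre x) (r * qi x) (r * qj x) (r * qk x)"

instance
  by standard (auto simp: quat_ops scaleR_quat_def algebra_simps)

end

lemma quat_sel [simp]:
  fixes x y :: quat
  shows "qre 0 = 0" "qi 0 = 0" "qj 0 = 0" "qk 0 = 0"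
    "qre 1 = 1" "qi 1 = 0" "qj 1 = 0" "qk 1 = 0"
    "qre (x + y) = qre x + qre y" "qi (x + y) = qi x + qi y"
    "qj (x + y) = qj x + qj y" "qk (x + y) = qk x + qk y"
    "qre (x - y) = qre x - qre y" "qi (x - y) = qi x - qi y"
    "qj (x - y) = qj x - qj y" "qk (x - y) = qk x - qk y"
    "qre (- x) = - qre x" "qi (- x) = - qi x" "qj (- x) = - qj x" "qk (- x) = - qk x"
    "qre (r *\<^sub>R x) = r * qre x" "qi (r *\<^sub>R x) = r * qi x"
    "qj (r *\<^sub>R x) = r * qj x" "qk (r *\<^sub>R x) = r * qk x"
  by (simp_all add: quat_ops scaleR_quat_def)

lemma quat_sel_times:
  "qre (x * y) = qre x * qre y - qi x * qi y - qj x * qj y - qk x * qk y"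
  "qi (x * y) = qre x * qi y + qi x * qre y + qj x * qk y - qk x * qj y"
  "qj (x * y) = qre x * qj y - qi x * qk y + qj x * qre y + qk x * qi y"
  "qk (x * y) = qre x * qk y + qi x * qj y - qj x * qi y + qk x * qre y"
  by (simp_all add: times_quat_def)

instantiation quat :: real_inner
begin

definition "inner x y = qre x * qre y + qi x * qi y + qj x * qj y + qk x * qk y"
  for x y :: quat
definition "norm x = sqrt (inner x x)" for x :: quat
definition "sgn x = x /\<^sub>R norm x" for x :: quat
definition "dist x y = norm (x - y)" for x y :: quat
definition [code del]:
  "(uniformity :: (quat \<times> quat) filter) = (INF e\<in>{0<..}. principal {(x, y). dist x y < e})"
definition [code del]:
  "open (U :: quat set) \<longleftrightarrow> (\<forall>x\<in>U. eventually (\<lambda>(x', y). x' = x \<longrightarrow> y \<in> U) uniformity)"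

instance
proof
  fix x y z :: quat and r :: real and S :: "quat set"
  show "inner x x = 0 \<longleftrightarrow> x = 0"
  proof
    assume "inner x x = 0"
    then have "(qre x)\<^sup>2 + (qi x)\<^sup>2 + (qj x)\<^sup>2 + (qk x)\<^sup>2 = 0"
      by (simp add: inner_quat_def power2_eq_square)
    then show "x = 0"
      by (simp add: quat_eq_iff add_nonneg_eq_0_iff)
  qed (simp add: inner_quat_def)
qed (auto simp: inner_quat_def norm_quat_def sgn_quat_def dist_quat_def
      uniformity_quat_def open_quat_def algebra_simps)

end

instance quat :: real_normed_algebra_1
proof
  fix x y :: quat
  have "inner (x * y) (x * y) = inner x x * inner y y"
    by (simp add: inner_quat_def quat_sel_times) algebra
  then show "norm (x * y) \<le> norm x * norm y"
    by (simp add: norm_quat_def real_sqrt_mult)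
qed (simp add: norm_quat_def inner_quat_def)

instantiation quat :: euclidean_space
begin

definition "Basis = {Quat 1 0 0 0, Quat 0 1 0 0, Quat 0 0 1 0, Quat 0 0 0 1}"

instance
proof
  show "(\<forall>u\<in>Basis. inner x u = 0) \<longleftrightarrow> x = 0" for x :: quat
    by (cases x) (simp add: Basis_quat_def inner_quat_def zero_quat_def)
  show "inner u v = (if u = v then 1 else 0)" if "u \<in> Basis" "v \<in> Basis" for u v :: quat
    using that unfolding Basis_quat_def by (elim insertE emptyE) (simp_all add: inner_quat_def)
qed (simp_all add: Basis_quat_def)

end

definition qcnj :: "quat \<Rightarrow> quat" where
  "qcnj x = Quat (qre x) (- qi x) (- qj x) (- qk x)"

lemma qcnj_simps [simp]:
  "qcnj (qcnj x) = x" "qcnj 0 = 0" "qcnj 1 = 1" "qcnj (- x) = - qcnj x"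
  "qcnj (x + y) = qcnj x + qcnj y" "qcnj (x - y) = qcnj x - qcnj y"
  "qcnj (r *\<^sub>R x) = r *\<^sub>R qcnj x"
  by (simp_all add: qcnj_def quat_eq_iff)

lemma qcnj_mult: "qcnj (x * y) = qcnj y * qcnj x"
  by (simp add: qcnj_def quat_eq_iff quat_sel_times algebra_simps)

lemma qcnj_sum: "qcnj (sum f S) = (\<Sum>x\<in>S. qcnj (f x))"
  by (induction S rule: infinite_finite_induct) auto


section \<open>The quaternionic unitary groups\<close>

definition qadjoint :: "quat^'n^'n \<Rightarrow> quat^'n^'n" where
  "qadjoint A = (\<chi> i j. qcnj (A $ j $ i))"

definition Sp :: "(quat^'n^'n) monoid" where
  "Sp = \<lparr>carrier = {A. A ** qadjoint A = mat 1 \<and> qadjoint A ** A = mat 1},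
         mult = (**), one = mat 1\<rparr>"

lemma qadjoint_mult: "qadjoint (A ** B) = qadjoint B ** qadjoint A"
  by (simp add: qadjoint_def matrix_matrix_mult_def vec_eq_iff qcnj_sum qcnj_mult)

lemma qadjoint_simps [simp]:
  "qadjoint (qadjoint A) = A" "qadjoint (mat 1) = mat 1" "qadjoint (- A) = - qadjoint A"
  by (auto simp: qadjoint_def mat_def vec_eq_iff)

lemma quat_matrix_minus [simp]:
  fixes A B :: "quat^'n^'n"
  shows "(- A) ** B = - (A ** B)" "A ** (- B) = - (A ** B)"
  by (simp_all add: matrix_matrix_mult_def vec_eq_iff sum_negf)

lemma group_Sp: "group (Sp :: (quat^'n^'n) monoid)"
proof (rule groupI)
  fix A B C :: "quat^'n^'n"
  assume A: "A \<in> carrier Sp" and B: "B \<in> carrier Sp"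
  have "(A ** B) ** qadjoint (A ** B) = A ** (B ** qadjoint B) ** qadjoint A"
    by (simp add: qadjoint_mult matrix_mul_assoc)
  moreover have "qadjoint (A ** B) ** (A ** B) = qadjoint B ** (qadjoint A ** A) ** B"
    by (simp add: qadjoint_mult matrix_mul_assoc)
  ultimately show "A \<otimes>\<^bsub>Sp\<^esub> B \<in> carrier Sp"
    using A B by (simp add: Sp_def)
next
  fix A :: "quat^'n^'n"
  assume "A \<in> carrier Sp"
  then show "\<exists>B\<in>carrier Sp. B \<otimes>\<^bsub>Sp\<^esub> A = \<one>\<^bsub>Sp\<^esub>"
    by (intro bexI[of _ "qadjoint A"]) (auto simp: Sp_def)
qed (auto simp: Sp_def matrix_mul_assoc)


section \<open>The Cayley algebra\<close>

text \<open>The element \<open>Oct m a\<close> stands for $m + a e_4$.\<close>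

datatype octonion = Oct (hpart: quat) (epart: quat)

lemma octonion_eq_iff: "x = y \<longleftrightarrow> hpart x = hpart y \<and> epart x = epart y"
  by (cases x; cases y) auto

instantiation octonion :: "{ab_group_add, one, times}"
begin

definition "0 = Oct 0 0"
definition "1 = Oct 1 0"
definition "x + y = Oct (hpart x + hpart y) (epart x + epart y)"
definition "- x = Oct (- hpart x) (- epart x)"
definition "x - y = Oct (hpart x - hpart y) (epart x - epart y)"
definition "x * y = Oct
  (hpart x * hpart y - qcnj (epart y) * epart x)
  (epart x * qcnj (hpart y) + epart y * hpart x)"

lemmas octonion_ops = zero_octonion_def one_octonion_def plus_octonion_def
  uminus_octonion_def minus_octonion_def times_octonion_def

instance
  by standard (auto simp: octonion_ops algebra_simps)

end

instantiation octonion :: real_vector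
begin

definition "r *\<^sub>R x = Oct (r *\<^sub>R hpart x) (r *\<^sub>R epart x)"

instance
  by standard (auto simp: octonion_ops scaleR_octonion_def algebra_simps)

end

lemma octonion_sel [simp]:
  fixes x y :: octonion
  shows "hpart 0 = 0" "epart 0 = 0" "hpart 1 = 1" "epart 1 = 0"
    "hpart (x + y) = hpart x + hpart y" "epart (x + y) = epart x + epart y"
    "hpart (x - y) = hpart x - hpart y" "epart (x - y) = epart x - epart y"
    "hpart (- x) = - hpart x" "epart (- x) = - epart x"
    "hpart (r *\<^sub>R x) = r *\<^sub>R hpart x" "epart (r *\<^sub>R x) = r *\<^sub>R epart x"
  by (simp_all add: octonion_ops scaleR_octonion_def)

instantiation octonion :: real_inner
begin

definition "inner x y = inner (hpart x) (hpart y) + inner (epart x) (epart y)"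
  for x y :: octonion
definition "norm x = sqrt (inner x x)" for x :: octonion
definition "sgn x = x /\<^sub>R norm x" for x :: octonion
definition "dist x y = norm (x - y)" for x y :: octonion
definition [code del]:
  "(uniformity :: (octonion \<times> octonion) filter) =
     (INF e\<in>{0<..}. principal {(x, y). dist x y < e})"
definition [code del]:
  "open (U :: octonion set) \<longleftrightarrow>
     (\<forall>x\<in>U. eventually (\<lambda>(x', y). x' = x \<longrightarrow> y \<in> U) uniformity)"

instance
proof
  fix x y z :: octonion and r :: real
  show "inner x y = inner y x"
    by (simp add: inner_octonion_def inner_commute)
  show "inner (x + y) z = inner x z + inner y z"
    by (simp add: inner_octonion_def inner_left_distrib)
  show "inner (r *\<^sub>R x) y = r * inner x y"
    by (simp add: inner_octonion_def distrib_left)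
  show "0 \<le> inner x x"
    by (simp add: inner_octonion_def)
  show "inner x x = 0 \<longleftrightarrow> x = 0"
    by (simp add: inner_octonion_def octonion_eq_iff add_nonneg_eq_0_iff)
qed (rule norm_octonion_def sgn_octonion_def dist_octonion_def
      uniformity_octonion_def open_octonion_def)+

end

instantiation octonion :: euclidean_space
begin

definition "Basis = (\<lambda>b. Oct b 0) ` Basis \<union> (\<lambda>b. Oct 0 b) ` Basis"

instance
proof
  fix x :: octonion
  show "(\<forall>u\<in>Basis. inner x u = 0) \<longleftrightarrow> x = 0"
    by (auto simp: Basis_octonion_def inner_octonion_def octonion_eq_iff ball_Un
        euclidean_all_zero_iff)
qed (auto simp: Basis_octonion_def inner_octonion_def inner_Basis split: if_splits)

end

definition ocnj :: "octonion \<Rightarrow> octonion" where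
  "ocnj x = Oct (qcnj (hpart x)) (- epart x)"

lemma ocnj_simps [simp]:
  "ocnj (ocnj x) = x" "ocnj 0 = 0" "ocnj (- x) = - ocnj x"
  "ocnj (x + y) = ocnj x + ocnj y" "ocnj (r *\<^sub>R x) = r *\<^sub>R ocnj x"
  by (simp_all add: ocnj_def octonion_eq_iff)

lemma ocnj_mult: "ocnj (x * y) = ocnj y * ocnj x"
  by (simp add: ocnj_def times_octonion_def qcnj_mult)

lemma ocnj_sum: "ocnj (sum f S) = (\<Sum>x\<in>S. ocnj (f x))"
  by (induction S rule: infinite_finite_induct) auto

lemma octonion_scaleR_mult:
  fixes x y :: octonion
  shows "(r *\<^sub>R x) * y = r *\<^sub>R (x * y)" "x * (r *\<^sub>R y) = r *\<^sub>R (x * y)"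
  by (simp_all add: times_octonion_def scaleR_octonion_def scaleR_diff_right scaleR_add_right)


section \<open>The exceptional Jordan algebra\<close>

text \<open>The library product \<open>(**)\<close> needs a \<open>semiring_1\<close>, so it does not apply to
  matrices over the non-associative Cayley algebra.\<close>

definition omult :: "octonion^3^3 \<Rightarrow> octonion^3^3 \<Rightarrow> octonion^3^3" where
  "omult X Y = (\<chi> i j. \<Sum>k\<in>UNIV. X $ i $ k * Y $ k $ j)"

definition oadjoint :: "octonion^3^3 \<Rightarrow> octonion^3^3" where
  "oadjoint X = (\<chi> i j. ocnj (X $ j $ i))"

definition JJ :: "(octonion^3^3) set" where
  "JJ = {X. oadjoint X = X}"

definition jordan :: "octonion^3^3 \<Rightarrow> octonion^3^3 \<Rightarrow> octonion^3^3" (infixl "\<circ>\<^sub>J" 70) where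
  "X \<circ>\<^sub>J Y = (1/2) *\<^sub>R (omult X Y + omult Y X)"

definition jmat ::
  "real \<Rightarrow> real \<Rightarrow> real \<Rightarrow> octonion \<Rightarrow> octonion \<Rightarrow> octonion \<Rightarrow> octonion^3^3" where
  "jmat \<xi>1 \<xi>2 \<xi>3 x1 x2 x3 = vector
     [vector [\<xi>1 *\<^sub>R 1, x3, ocnj x2],
      vector [ocnj x3, \<xi>2 *\<^sub>R 1, x1],
      vector [x2, ocnj x1, \<xi>3 *\<^sub>R 1]]"

definition jdiag :: "3 \<Rightarrow> octonion^3^3 \<Rightarrow> real" where
  "jdiag k X = qre (hpart (X $ k $ k))"

lemma jmat_nth:
  "jmat a b c x y z $ 1 $ 1 = a *\<^sub>R 1" "jmat a b c x y z $ 1 $ 2 = z"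
  "jmat a b c x y z $ 1 $ 3 = ocnj y" "jmat a b c x y z $ 2 $ 1 = ocnj z"
  "jmat a b c x y z $ 2 $ 2 = b *\<^sub>R 1" "jmat a b c x y z $ 2 $ 3 = x"
  "jmat a b c x y z $ 3 $ 1 = y" "jmat a b c x y z $ 3 $ 2 = ocnj x"
  "jmat a b c x y z $ 3 $ 3 = c *\<^sub>R 1"
  by (simp_all add: jmat_def)

lemma jmat_in_JJ: "jmat a b c x y z \<in> JJ"
  unfolding JJ_def oadjoint_def
  by (simp add: vec_eq_iff forall_3 jmat_nth) (simp add: ocnj_def qcnj_def octonion_eq_iff quat_eq_iff)

lemma jmat_expand:
  assumes "X \<in> JJ"
  shows "X = jmat (jdiag 1 X) (jdiag 2 X) (jdiag 3 X) (X $ 2 $ 3) (X $ 3 $ 1) (X $ 1 $ 2)"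
proof -
  have *: "ocnj (X $ j $ i) = X $ i $ j" for i j
  proof -
    have "oadjoint X $ i $ j = X $ i $ j" using assms by (simp add: JJ_def)
    then show ?thesis by (simp add: oadjoint_def)
  qed
  have d: "jdiag k X *\<^sub>R 1 = X $ k $ k" for k
    using *[of k k] by (auto simp: jdiag_def ocnj_def qcnj_def octonion_eq_iff quat_eq_iff)
  show ?thesis
    by (simp add: vec_eq_iff forall_3 jmat_nth * d)
qed

lemma JJ_nth: "X \<in> JJ \<Longrightarrow> ocnj (X $ j $ i) = X $ i $ j"
  unfolding JJ_def oadjoint_def by (simp add: vec_eq_iff)

lemma JJ_I: "(\<And>i j. ocnj (X $ j $ i) = X $ i $ j) \<Longrightarrow> X \<in> JJ"
  unfolding JJ_def oadjoint_def by (simp add: vec_eq_iff)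

lemma JJ_add: "X \<in> JJ \<Longrightarrow> Y \<in> JJ \<Longrightarrow> X + Y \<in> JJ"
  by (rule JJ_I) (simp add: JJ_nth)

lemma JJ_scaleR: "X \<in> JJ \<Longrightarrow> r *\<^sub>R X \<in> JJ"
  by (rule JJ_I) (simp add: JJ_nth)

lemma JJ_jordan: "X \<in> JJ \<Longrightarrow> Y \<in> JJ \<Longrightarrow> X \<circ>\<^sub>J Y \<in> JJ"
  by (rule JJ_I) (simp add: jordan_def omult_def ocnj_sum ocnj_mult JJ_nth add.commute)


section \<open>The group $F_4$ and the fixed subgroup\<close>

definition F4_set :: "(octonion^3^3 \<Rightarrow> octonion^3^3) set" where
  "F4_set = {\<alpha> \<in> Bij JJ.
     (\<forall>X\<in>JJ. \<forall>Y\<in>JJ. \<alpha> (X + Y) = \<alpha> X + \<alpha> Y) \<and>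
     (\<forall>r. \<forall>X\<in>JJ. \<alpha> (r *\<^sub>R X) = r *\<^sub>R \<alpha> X) \<and>
     (\<forall>X\<in>JJ. \<forall>Y\<in>JJ. \<alpha> (X \<circ>\<^sub>J Y) = \<alpha> X \<circ>\<^sub>J \<alpha> Y)}"

definition F4 :: "(octonion^3^3 \<Rightarrow> octonion^3^3) monoid" where
  "F4 = (BijGroup JJ)\<lparr>carrier := F4_set\<rparr>"

lemma subgroup_F4: "subgroup F4_set (BijGroup JJ)"
proof (rule group.subgroupI[OF group_BijGroup])
  show "F4_set \<subseteq> carrier (BijGroup JJ)"
    by (auto simp: F4_set_def BijGroup_def)
  show "F4_set \<noteq> {}"
    using id_Bij[of JJ] by (auto simp: F4_set_def JJ_add JJ_scaleR JJ_jordan intro!: exI[of _ "\<lambda>X\<in>JJ. X"])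
next
  fix \<alpha> assume \<alpha>: "\<alpha> \<in> F4_set"
  then have B: "\<alpha> \<in> Bij JJ" by (simp add: F4_set_def)
  then have bij: "bij_betw \<alpha> JJ JJ" by (simp add: Bij_def)
  define \<beta> where "\<beta> = inv_into JJ \<alpha>"
  have \<beta>: "\<beta> X \<in> JJ" "\<alpha> (\<beta> X) = X" if "X \<in> JJ" for X
    using that bij B unfolding \<beta>_def by (auto simp: Bij_inv_into_mem bij_betw_inv_into_right)
  have eq: "\<beta> X = Y" if "X \<in> JJ" "Y \<in> JJ" "\<alpha> Y = X" for X Y
    using that bij unfolding \<beta>_def by (metis bij_betw_inv_into_left)
  have "restrict \<beta> JJ \<in> F4_set"
    using \<alpha> restrict_inv_into_Bij[OF B]
    unfolding F4_set_def
    by (auto simp: JJ_add JJ_scaleR JJ_jordan \<beta> simp flip: \<beta>_def intro!: eq)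
  then show "inv\<^bsub>BijGroup JJ\<^esub> \<alpha> \<in> F4_set"
    using B by (simp add: inv_BijGroup \<beta>_def)
next
  fix \<alpha> \<beta> assume \<alpha>: "\<alpha> \<in> F4_set" and \<beta>: "\<beta> \<in> F4_set"
  then have B: "\<alpha> \<in> Bij JJ" "\<beta> \<in> Bij JJ" by (auto simp: F4_set_def)
  then have "\<beta> X \<in> JJ" if "X \<in> JJ" for X
    using that Bij_imp_funcset by blast
  then have "compose JJ \<alpha> \<beta> \<in> F4_set"
    using \<alpha> \<beta> compose_Bij[OF B] unfolding F4_set_def
    by (auto simp: compose_def JJ_add JJ_scaleR JJ_jordan)
  then show "\<alpha> \<otimes>\<^bsub>BijGroup JJ\<^esub> \<beta> \<in> F4_set"
    using B by (simp add: BijGroup_def)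
qed

lemma group_F4: "group F4"
  unfolding F4_def by (rule subgroup.subgroup_is_group[OF subgroup_F4 group_BijGroup])

lemma carrier_F4 [simp]: "carrier F4 = F4_set"
  by (simp add: F4_def)

lemma one_F4: "\<one>\<^bsub>F4\<^esub> = (\<lambda>X\<in>JJ. X)"
  by (simp add: F4_def BijGroup_def)

lemma mult_F4: "\<alpha> \<in> F4_set \<Longrightarrow> \<beta> \<in> F4_set \<Longrightarrow> \<alpha> \<otimes>\<^bsub>F4\<^esub> \<beta> = compose JJ \<alpha> \<beta>"
  by (simp add: F4_def BijGroup_def F4_set_def)

lemma F4_involutionI:
  assumes ext: "\<alpha> \<in> extensional JJ"
    and cl: "\<And>X. X \<in> JJ \<Longrightarrow> \<alpha> X \<in> JJ" and inv: "\<And>X. X \<in> JJ \<Longrightarrow> \<alpha> (\<alpha> X) = X"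
    and "\<And>X Y. X \<in> JJ \<Longrightarrow> Y \<in> JJ \<Longrightarrow> \<alpha> (X + Y) = \<alpha> X + \<alpha> Y"
    and "\<And>r X. X \<in> JJ \<Longrightarrow> \<alpha> (r *\<^sub>R X) = r *\<^sub>R \<alpha> X"
    and "\<And>X Y. X \<in> JJ \<Longrightarrow> Y \<in> JJ \<Longrightarrow> \<alpha> (X \<circ>\<^sub>J Y) = \<alpha> X \<circ>\<^sub>J \<alpha> Y"
  shows "\<alpha> \<in> F4_set"
proof -
  have "bij_betw \<alpha> JJ JJ"
    by (rule bij_betw_byWitness[of _ \<alpha>]) (auto simp: cl inv)
  then show ?thesis using assms by (auto simp: F4_set_def Bij_def)
qed

definition jsigma :: "octonion^3^3 \<Rightarrow> octonion^3^3" where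
  "jsigma = (\<lambda>X\<in>JJ. jmat (jdiag 1 X) (jdiag 2 X) (jdiag 3 X)
                        (X $ 2 $ 3) (- (X $ 3 $ 1)) (- (X $ 1 $ 2)))"

definition ogamma :: "octonion \<Rightarrow> octonion" where
  "ogamma x = Oct (hpart x) (- epart x)"

definition jgamma :: "octonion^3^3 \<Rightarrow> octonion^3^3" where
  "jgamma = (\<lambda>X\<in>JJ. jmat (jdiag 1 X) (jdiag 2 X) (jdiag 3 X)
                        (ogamma (X $ 2 $ 3)) (ogamma (X $ 3 $ 1)) (ogamma (X $ 1 $ 2)))"

definition jsign :: "3 \<Rightarrow> real" where
  "jsign i = (if i = 1 then 1 else - 1)"

lemma jsigma_jmat: "jsigma (jmat a b c x y z) = jmat a b c x (- y) (- z)"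
  by (simp add: jsigma_def jmat_in_JJ jmat_nth jdiag_def)

lemma jgamma_jmat:
  "jgamma (jmat a b c x y z) = jmat a b c (ogamma x) (ogamma y) (ogamma z)"
  by (simp add: jgamma_def jmat_in_JJ jmat_nth jdiag_def)

lemma jsigma_nth:
  assumes "X \<in> JJ"
  shows "jsigma X $ i $ j = (jsign i * jsign j) *\<^sub>R (X $ i $ j)"
proof -
  obtain a b c x y z where X: "X = jmat a b c x y z"
    using jmat_expand[OF assms] by blast
  have "\<forall>i j. jsigma X $ i $ j = (jsign i * jsign j) *\<^sub>R (X $ i $ j)"
    unfolding X jsigma_jmat by (simp add: forall_3 jmat_nth jsign_def)
  then show ?thesis by blast
qed

lemma ogamma_simps [simp]:
  "ogamma (ogamma x) = x" "ogamma (x + y) = ogamma x + ogamma y"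
  "ogamma (r *\<^sub>R x) = r *\<^sub>R ogamma x" "ogamma (ocnj x) = ocnj (ogamma x)"
  "ogamma (x * y) = ogamma x * ogamma y" "ogamma 1 = 1" "ogamma 0 = 0"
  by (simp_all add: ogamma_def ocnj_def octonion_eq_iff times_octonion_def)

lemma ogamma_sum: "ogamma (sum f S) = (\<Sum>x\<in>S. ogamma (f x))"
  by (induction S rule: infinite_finite_induct) auto

lemma jgamma_nth:
  assumes "X \<in> JJ"
  shows "jgamma X $ i $ j = ogamma (X $ i $ j)"
proof -
  obtain a b c x y z where X: "X = jmat a b c x y z"
    using jmat_expand[OF assms] by blast
  have "\<forall>i j. jgamma X $ i $ j = ogamma (X $ i $ j)"
    unfolding X jgamma_jmat by (simp add: forall_3 jmat_nth)
  then show ?thesis by blast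
qed

lemma jsigma_in_JJ: "X \<in> JJ \<Longrightarrow> jsigma X \<in> JJ"
  by (simp add: jsigma_def jmat_in_JJ)

lemma jgamma_in_JJ: "X \<in> JJ \<Longrightarrow> jgamma X \<in> JJ"
  by (simp add: jgamma_def jmat_in_JJ)

lemma jsigma_in_F4: "jsigma \<in> F4_set"
proof (rule F4_involutionI)
  fix X Y assume X: "X \<in> JJ" and Y: "Y \<in> JJ"
  have *: "omult (jsigma U) (jsigma V) $ i $ j = (jsign i * jsign j) *\<^sub>R (omult U V $ i $ j)"
    if "U \<in> JJ" "V \<in> JJ" for U V i j
  proof -
    have sgn: "jsign i * jsign k * (jsign k * jsign j) = jsign i * jsign j" for k
      by (simp add: jsign_def)
    have "omult (jsigma U) (jsigma V) $ i $ j =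
        (\<Sum>k\<in>UNIV. (jsign i * jsign k * (jsign k * jsign j)) *\<^sub>R (U $ i $ k * V $ k $ j))"
      using that by (simp add: omult_def jsigma_nth octonion_scaleR_mult mult.commute)
    then show ?thesis
      unfolding sgn by (simp add: omult_def scaleR_sum_right)
  qed
  show "jsigma (X \<circ>\<^sub>J Y) = jsigma X \<circ>\<^sub>J jsigma Y"
    using X Y by (simp add: vec_eq_iff jsigma_nth JJ_jordan)
      (simp add: jordan_def * scaleR_add_right mult.commute)
  show "jsigma (X + Y) = jsigma X + jsigma Y"
    using X Y by (simp add: vec_eq_iff jsigma_nth JJ_add scaleR_add_right)
next
  fix r X assume X: "X \<in> JJ"
  show "jsigma (r *\<^sub>R X) = r *\<^sub>R jsigma X"
    using X by (simp add: vec_eq_iff jsigma_nth JJ_scaleR)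
  show "jsigma (jsigma X) = X"
    using X by (simp add: vec_eq_iff jsigma_nth jsigma_in_JJ jsign_def)
qed (simp_all add: jsigma_in_JJ, simp add: jsigma_def)

lemma jgamma_in_F4: "jgamma \<in> F4_set"
proof (rule F4_involutionI)
  fix X Y assume X: "X \<in> JJ" and Y: "Y \<in> JJ"
  have *: "omult (jgamma U) (jgamma V) $ i $ j = ogamma (omult U V $ i $ j)"
    if "U \<in> JJ" "V \<in> JJ" for U V i j
    using that by (simp add: omult_def jgamma_nth ogamma_sum)
  show "jgamma (X \<circ>\<^sub>J Y) = jgamma X \<circ>\<^sub>J jgamma Y"
    using X Y by (simp add: vec_eq_iff jgamma_nth JJ_jordan) (simp add: jordan_def *)
  show "jgamma (X + Y) = jgamma X + jgamma Y"
    using X Y by (simp add: vec_eq_iff jgamma_nth JJ_add)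
next
  fix r X assume X: "X \<in> JJ"
  show "jgamma (r *\<^sub>R X) = r *\<^sub>R jgamma X"
    using X by (simp add: vec_eq_iff jgamma_nth JJ_scaleR)
  show "jgamma (jgamma X) = X"
    using X by (simp add: vec_eq_iff jgamma_nth jgamma_in_JJ)
qed (simp_all add: jgamma_in_JJ, simp add: jgamma_def)

lemma jsigma_jgamma_commuting_involutions:
  "jsigma \<otimes>\<^bsub>F4\<^esub> jsigma = \<one>\<^bsub>F4\<^esub>" "jgamma \<otimes>\<^bsub>F4\<^esub> jgamma = \<one>\<^bsub>F4\<^esub>"
  "jsigma \<otimes>\<^bsub>F4\<^esub> jgamma = jgamma \<otimes>\<^bsub>F4\<^esub> jsigma"
proof -
  have comp: "\<alpha> \<otimes>\<^bsub>F4\<^esub> \<beta> = (\<lambda>X\<in>JJ. \<alpha> (\<beta> X))" if "\<alpha> \<in> F4_set" "\<beta> \<in> F4_set" for \<alpha> \<beta>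
    using that by (simp add: mult_F4 compose_def)
  have "jsigma (jsigma X) = X" "jgamma (jgamma X) = X" "jsigma (jgamma X) = jgamma (jsigma X)"
    if "X \<in> JJ" for X
    using that
    by (simp_all add: vec_eq_iff jsigma_nth jgamma_nth jsigma_in_JJ jgamma_in_JJ jsign_def)
  then show "jsigma \<otimes>\<^bsub>F4\<^esub> jsigma = \<one>\<^bsub>F4\<^esub>" "jgamma \<otimes>\<^bsub>F4\<^esub> jgamma = \<one>\<^bsub>F4\<^esub>"
    "jsigma \<otimes>\<^bsub>F4\<^esub> jgamma = jgamma \<otimes>\<^bsub>F4\<^esub> jsigma"
    by (simp_all add: comp jsigma_in_F4 jgamma_in_F4 one_F4 cong: restrict_cong)
qed

definition F4_sigma_gamma :: "(octonion^3^3 \<Rightarrow> octonion^3^3) monoid" where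
  "F4_sigma_gamma = F4\<lparr>carrier := {\<alpha> \<in> carrier F4.
     jsigma \<otimes>\<^bsub>F4\<^esub> \<alpha> = \<alpha> \<otimes>\<^bsub>F4\<^esub> jsigma \<and> jgamma \<otimes>\<^bsub>F4\<^esub> \<alpha> = \<alpha> \<otimes>\<^bsub>F4\<^esub> jgamma}\<rparr>"

lemma group_F4_sigma_gamma: "group F4_sigma_gamma"
proof -
  interpret group F4 by (rule group_F4)
  have s: "jsigma \<in> carrier F4" and g: "jgamma \<in> carrier F4"
    by (simp_all add: jsigma_in_F4 jgamma_in_F4)
  have "subgroup {\<alpha> \<in> carrier F4. jsigma \<otimes>\<^bsub>F4\<^esub> \<alpha> = \<alpha> \<otimes>\<^bsub>F4\<^esub> jsigma \<and>
      jgamma \<otimes>\<^bsub>F4\<^esub> \<alpha> = \<alpha> \<otimes>\<^bsub>F4\<^esub> jgamma} F4"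
  proof (rule subgroupI)
    show "{\<alpha> \<in> carrier F4. jsigma \<otimes>\<^bsub>F4\<^esub> \<alpha> = \<alpha> \<otimes>\<^bsub>F4\<^esub> jsigma \<and>
        jgamma \<otimes>\<^bsub>F4\<^esub> \<alpha> = \<alpha> \<otimes>\<^bsub>F4\<^esub> jgamma} \<noteq> {}"
      using s g one_closed l_one r_one by (metis (mono_tags, lifting) empty_iff mem_Collect_eq)
  next
    fix \<alpha>
    have *: "x \<otimes>\<^bsub>F4\<^esub> inv\<^bsub>F4\<^esub> a = inv\<^bsub>F4\<^esub> a \<otimes>\<^bsub>F4\<^esub> x"
      if "x \<in> carrier F4" "a \<in> carrier F4" "x \<otimes>\<^bsub>F4\<^esub> a = a \<otimes>\<^bsub>F4\<^esub> x" for x a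
      using that by (metis inv_closed inv_solve_left inv_solve_right m_assoc m_closed)
    assume "\<alpha> \<in> {\<alpha> \<in> carrier F4. jsigma \<otimes>\<^bsub>F4\<^esub> \<alpha> = \<alpha> \<otimes>\<^bsub>F4\<^esub> jsigma \<and>
        jgamma \<otimes>\<^bsub>F4\<^esub> \<alpha> = \<alpha> \<otimes>\<^bsub>F4\<^esub> jgamma}"
    then show "inv\<^bsub>F4\<^esub> \<alpha> \<in> {\<alpha> \<in> carrier F4. jsigma \<otimes>\<^bsub>F4\<^esub> \<alpha> = \<alpha> \<otimes>\<^bsub>F4\<^esub> jsigma \<and>
        jgamma \<otimes>\<^bsub>F4\<^esub> \<alpha> = \<alpha> \<otimes>\<^bsub>F4\<^esub> jgamma}"
      using s g * by (simp del: carrier_F4)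
  next
    fix \<alpha> \<beta>
    have *: "x \<otimes>\<^bsub>F4\<^esub> (a \<otimes>\<^bsub>F4\<^esub> b) = (a \<otimes>\<^bsub>F4\<^esub> b) \<otimes>\<^bsub>F4\<^esub> x"
      if "x \<in> carrier F4" "a \<in> carrier F4" "b \<in> carrier F4"
        "x \<otimes>\<^bsub>F4\<^esub> a = a \<otimes>\<^bsub>F4\<^esub> x" "x \<otimes>\<^bsub>F4\<^esub> b = b \<otimes>\<^bsub>F4\<^esub> x" for x a b
      using that by (metis m_assoc)
    assume "\<alpha> \<in> {\<alpha> \<in> carrier F4. jsigma \<otimes>\<^bsub>F4\<^esub> \<alpha> = \<alpha> \<otimes>\<^bsub>F4\<^esub> jsigma \<and>
        jgamma \<otimes>\<^bsub>F4\<^esub> \<alpha> = \<alpha> \<otimes>\<^bsub>F4\<^esub> jgamma}"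
      "\<beta> \<in> {\<alpha> \<in> carrier F4. jsigma \<otimes>\<^bsub>F4\<^esub> \<alpha> = \<alpha> \<otimes>\<^bsub>F4\<^esub> jsigma \<and>
        jgamma \<otimes>\<^bsub>F4\<^esub> \<alpha> = \<alpha> \<otimes>\<^bsub>F4\<^esub> jgamma}"
    then show "\<alpha> \<otimes>\<^bsub>F4\<^esub> \<beta> \<in> {\<alpha> \<in> carrier F4. jsigma \<otimes>\<^bsub>F4\<^esub> \<alpha> = \<alpha> \<otimes>\<^bsub>F4\<^esub> jsigma \<and>
        jgamma \<otimes>\<^bsub>F4\<^esub> \<alpha> = \<alpha> \<otimes>\<^bsub>F4\<^esub> jgamma}"
      using s g * by (simp del: carrier_F4)
  qed blast
  then show ?thesis
    unfolding F4_sigma_gamma_def by (rule subgroup.subgroup_is_group) (rule group_F4)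
qed

text \<open>On linear maps of a finite-dimensional space the topology of pointwise convergence is
  the usual one, so this is the Lie group topology induced from $\mathrm{Iso}_{\mathbf R}(\mathfrak J)$.\<close>

definition topology_JJ_maps :: "(octonion^3^3 \<Rightarrow> octonion^3^3) topology" where
  "topology_JJ_maps = product_topology (\<lambda>_. top_of_set JJ) JJ"


section \<open>Isomorphism of Lie groups\<close>

definition quotient_topology :: "'a topology \<Rightarrow> ('a \<Rightarrow> 'b) \<Rightarrow> 'b topology" where
  "quotient_topology T f =
     topology (\<lambda>U. U \<subseteq> f ` topspace T \<and> openin T {x \<in> topspace T. f x \<in> U})"

lemma openin_quotient_topology:
  "openin (quotient_topology T f) U \<longleftrightarrow>
     U \<subseteq> f ` topspace T \<and> openin T {x \<in> topspace T. f x \<in> U}"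
proof -
  have "istopology (\<lambda>U. U \<subseteq> f ` topspace T \<and> openin T {x \<in> topspace T. f x \<in> U})"
    unfolding istopology_def
  proof (intro conjI allI impI)
    fix S S'
    assume S: "S \<subseteq> f ` topspace T \<and> openin T {x \<in> topspace T. f x \<in> S}"
      and S': "S' \<subseteq> f ` topspace T \<and> openin T {x \<in> topspace T. f x \<in> S'}"
    have "{x \<in> topspace T. f x \<in> S \<inter> S'} =
        {x \<in> topspace T. f x \<in> S} \<inter> {x \<in> topspace T. f x \<in> S'}" by blast
    then show "openin T {x \<in> topspace T. f x \<in> S \<inter> S'}"
      using S S' by (simp only: openin_Int)
    show "S \<inter> S' \<subseteq> f ` topspace T" using S by blast
  next
    fix K
    assume K: "\<forall>S\<in>K. S \<subseteq> f ` topspace T \<and> openin T {x \<in> topspace T. f x \<in> S}"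
    have "{x \<in> topspace T. f x \<in> \<Union> K} = \<Union> ((\<lambda>S. {x \<in> topspace T. f x \<in> S}) ` K)" by blast
    then show "openin T {x \<in> topspace T. f x \<in> \<Union> K}"
      using K by (simp only:) (intro openin_Union, blast)
    show "\<Union> K \<subseteq> f ` topspace T" using K by blast
  qed
  then show ?thesis
    unfolding quotient_topology_def by simp
qed

lemma topspace_quotient_topology [simp]:
  "topspace (quotient_topology T f) = f ` topspace T"
proof
  show "topspace (quotient_topology T f) \<subseteq> f ` topspace T"
    using openin_topspace[of "quotient_topology T f"] unfolding openin_quotient_topology by blast
  have "{x \<in> topspace T. f x \<in> f ` topspace T} = topspace T" by blast
  then have "openin (quotient_topology T f) (f ` topspace T)"
    unfolding openin_quotient_topology by simp
  then show "f ` topspace T \<subseteq> topspace (quotient_topology T f)"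
    by (rule openin_subset)
qed

lemma quotient_map_quotient_topology: "quotient_map T (quotient_topology T f) f"
  unfolding quotient_map_def by (auto simp: openin_quotient_topology)

text \<open>An isomorphism of Lie groups is a group isomorphism that is also a homeomorphism: a
  continuous homomorphism between Lie groups is automatically smooth.\<close>

definition lie_isomorphic ::
  "('a, 'm) monoid_scheme \<Rightarrow> 'a topology \<Rightarrow> ('b, 'n) monoid_scheme \<Rightarrow> 'b topology \<Rightarrow> bool" where
  "lie_isomorphic G T H T' \<longleftrightarrow> (\<exists>h\<in>iso G H. homeomorphic_map T T' h)"


section \<open>The quotient $(Sp(1)\times Sp(1)\times Sp(2))/\mathbf Z_2$\<close>

definition Sp112 :: "((quat^1^1) \<times> (quat^1^1) \<times> (quat^2^2)) monoid" where
  "Sp112 = Sp \<times>\<times> Sp \<times>\<times> Sp"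

definition Z2 :: "((quat^1^1) \<times> (quat^1^1) \<times> (quat^2^2)) set" where
  "Z2 = {(mat 1, mat 1, mat 1), (- mat 1, - mat 1, - mat 1)}"

lemma group_Sp112: "group Sp112"
  unfolding Sp112_def by (rule DirProd_group[OF group_Sp DirProd_group[OF group_Sp group_Sp]])

lemma normal_Z2: "Z2 \<lhd> Sp112"
proof -
  interpret group Sp112 by (rule group_Sp112)
  have sub: "subgroup Z2 Sp112"
  proof
    show "inv\<^bsub>Sp112\<^esub> x \<in> Z2" if "x \<in> Z2" for x
    proof -
      have "inv\<^bsub>Sp112\<^esub> x = x"
        using that by (intro inv_equality) (auto simp: Z2_def Sp112_def Sp_def)
      then show ?thesis using that by simp
    qed
  qed (auto simp: Z2_def Sp112_def Sp_def)
  show ?thesis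
  proof (rule normalI[OF sub], intro ballI)
    fix x assume "x \<in> carrier Sp112"
    have "h \<otimes>\<^bsub>Sp112\<^esub> x = x \<otimes>\<^bsub>Sp112\<^esub> h" if "h \<in> Z2" for h
      using that by (cases x) (auto simp: Z2_def Sp112_def Sp_def)
    then show "Z2 #>\<^bsub>Sp112\<^esub> x = x <#\<^bsub>Sp112\<^esub> Z2"
      by (simp add: r_coset_def l_coset_def)
  qed
qed

definition Sp112_quotient_topology :: "((quat^1^1) \<times> (quat^1^1) \<times> (quat^2^2)) set topology" where
  "Sp112_quotient_topology =
     quotient_topology (top_of_set (carrier Sp112)) (\<lambda>x. Z2 #>\<^bsub>Sp112\<^esub> x)"

end

theory Submission
  imports Defs
begin

text \<open>
  Write an element of the exceptional Jordan algebra as \<open>M + a\<close> with \<open>M\<close> a hermitian quaternionic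
  matrix and \<open>a\<close> a quaternionic row vector. For \<open>p \<in> Sp(1)\<close> and \<open>A = diag(q, B) \<in> Sp(1) \<times> Sp(2)\<close>
  the map \<open>M + a \<mapsto> A M A\<^sup>* + p a A\<^sup>*\<close> is an automorphism, which gives a homomorphism into the
  centralizer with kernel \<open>{\<plusminus>1}\<close>.

  For surjectivity, let \<open>\<beta>\<close> commute with \<open>\<sigma>\<close> and \<open>\<gamma>\<close>. It preserves the space of elements whose only
  nonzero entries are quaternions \<open>x\<^sub>2, x\<^sub>3\<close>, and the images of the two unit vectors there are the rows of
  an element of \<open>Sp(2)\<close>. Dividing by it, one may assume that \<open>\<beta>\<close> fixes all real matrices. Then \<open>\<beta>\<close> acts
  on the entries by a single automorphism of the octonions which preserves the quaternions; on these it
  is inner, \<open>m \<mapsto> r m r\<^sup>-\<^sup>1\<close>, and on \<open>H e\<^sub>4\<close> it is \<open>a \<mapsto> c r a r\<^sup>-\<^sup>1\<close>, so \<open>\<beta>\<close> is the image of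
  \<open>(c r, r, r E)\<close>. The resulting continuous bijection from a compact space to a Hausdorff space is
  a homeomorphism.
\<close>

section \<open>The action of $Sp(1)\times Sp(3)$ on the exceptional Jordan algebra\<close>

text \<open>Rectangular version of \<open>qadjoint\<close>: row vectors need adjoints too, since
  both \<open>madj a ** b\<close> and \<open>a ** madj b\<close> occur in the Jordan
  product.\<close>

definition madj :: "quat^'n^'m \<Rightarrow> quat^'m^'n" where
  "madj A = (\<chi> i j. qcnj (A $ j $ i))"

text \<open>Over the quaternions the full trace is not cyclic, but its real part is.\<close>

definition rtr :: "quat^'n^'n \<Rightarrow> real" where
  "rtr A = (\<Sum>i\<in>UNIV. qre (A $ i $ i))"

lemma madj_nth [simp]: "madj A $ i $ j = qcnj (A $ j $ i)"
  by (simp add: madj_def)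

lemma qadjoint_eq_madj: "qadjoint = madj"
  by (simp add: fun_eq_iff qadjoint_def madj_def)

lemma madj_simps [simp]:
  "madj (madj A) = A" "madj (mat 1) = mat 1" "madj 0 = 0" "madj (- A) = - madj A"
  "madj (A + B) = madj A + madj B" "madj (A - B) = madj A - madj B"
  "madj (r *\<^sub>R A) = r *\<^sub>R madj A"
  by (auto simp: vec_eq_iff mat_def)

lemma madj_mult: "madj (A ** B) = madj B ** madj A"
  by (simp add: matrix_matrix_mult_def vec_eq_iff qcnj_sum qcnj_mult)

lemma qmat_mult_nth: "(A ** B) $ i $ j = (\<Sum>k\<in>UNIV. A $ i $ k * B $ k $ j)"
  by (simp add: matrix_matrix_mult_def)

lemma qmat_simps:
  fixes A :: "quat^'n^'m"
  shows "A ** (B - C) = A ** B - A ** C"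
    "(D + E) ** B = D ** B + E ** B"
    "(D - E) ** B = D ** B - E ** B"
    "A ** (r *\<^sub>R B) = r *\<^sub>R (A ** B)"
    "(r *\<^sub>R A) ** B = r *\<^sub>R (A ** B)"
    "(- A) ** B = - (A ** B)"
    "A ** (- B) = - (A ** B)"
    "A ** 0 = 0" "0 ** B = 0"
  by (simp_all add: matrix_matrix_mult_def vec_eq_iff algebra_simps sum.distrib sum_subtractf
      sum_negf scaleR_sum_right)

lemma qre_sum: "qre (sum f S) = (\<Sum>x\<in>S. qre (f x))"
  by (induction S rule: infinite_finite_induct) auto

lemma qre_commute: "qre (x * y) = qre (y * x)"
  by (simp add: quat_sel_times)

lemma rtr_commute:
  fixes A :: "quat^'n^'m" and B :: "quat^'m^'n"
  shows "rtr (A ** B) = rtr (B ** A)"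
  unfolding rtr_def qmat_mult_nth qre_sum
  by (subst sum.swap) (simp add: qre_commute)

text \<open>The decomposition \<open>J = J(3,H) \<oplus> H\<^sup>3\<close>: \<open>jcomb M a\<close> is the element \<open>M + a\<close>, where
  the row vector \<open>a\<close> lists the \<open>e\<^sub>4\<close>-components of \<open>x\<^sub>1, x\<^sub>2, x\<^sub>3\<close>. It lies in \<open>JJ\<close> only for
  hermitian \<open>M\<close>.\<close>

definition jcomb :: "quat^3^3 \<Rightarrow> quat^3^1 \<Rightarrow> octonion^3^3" where
  "jcomb M a = vector
     [vector [Oct (M$1$1) 0, Oct (M$1$2) (a$1$3), Oct (M$1$3) (- a$1$2)],
      vector [Oct (M$2$1) (- a$1$3), Oct (M$2$2) 0, Oct (M$2$3) (a$1$1)],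
      vector [Oct (M$3$1) (a$1$2), Oct (M$3$2) (- a$1$1), Oct (M$3$3) 0]]"

definition hmat :: "octonion^3^3 \<Rightarrow> quat^3^3" where
  "hmat X = (\<chi> i j. hpart (X $ i $ j))"

definition erow :: "octonion^3^3 \<Rightarrow> quat^3^1" where
  "erow X = (\<chi> _. vector [epart (X $ 2 $ 3), epart (X $ 3 $ 1), epart (X $ 1 $ 2)])"

lemma jcomb_nth:
  "jcomb M a $ 1 $ 1 = Oct (M$1$1) 0" "jcomb M a $ 1 $ 2 = Oct (M$1$2) (a$1$3)"
  "jcomb M a $ 1 $ 3 = Oct (M$1$3) (- a$1$2)" "jcomb M a $ 2 $ 1 = Oct (M$2$1) (- a$1$3)"
  "jcomb M a $ 2 $ 2 = Oct (M$2$2) 0" "jcomb M a $ 2 $ 3 = Oct (M$2$3) (a$1$1)"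
  "jcomb M a $ 3 $ 1 = Oct (M$3$1) (a$1$2)" "jcomb M a $ 3 $ 2 = Oct (M$3$2) (- a$1$1)"
  "jcomb M a $ 3 $ 3 = Oct (M$3$3) 0"
  by (simp_all add: jcomb_def)

lemma erow_nth: "erow X $ i $ 1 = epart (X $ 2 $ 3)" "erow X $ i $ 2 = epart (X $ 3 $ 1)"
  "erow X $ i $ 3 = epart (X $ 1 $ 2)"
  by (simp_all add: erow_def)

lemma hmat_nth [simp]: "hmat X $ i $ j = hpart (X $ i $ j)"
  by (simp add: hmat_def)

lemma hmat_jcomb [simp]: "hmat (jcomb M a) = M"
  by (simp add: vec_eq_iff forall_3 jcomb_nth)

lemma erow_jcomb [simp]: "erow (jcomb M a) = a"
  by (simp add: vec_eq_iff forall_3 forall_1 jcomb_nth erow_nth)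

lemma jcomb_in_JJ: "madj M = M \<Longrightarrow> jcomb M a \<in> JJ"
  by (auto simp: JJ_def oadjoint_def vec_eq_iff forall_3 jcomb_nth ocnj_def)

lemma
  assumes "X \<in> JJ"
  shows madj_hmat: "madj (hmat X) = hmat X" and jcomb_hmat_erow: "jcomb (hmat X) (erow X) = X"
proof -
  have *: "X $ i $ j = ocnj (X $ j $ i)" for i j
    using JJ_nth[OF assms] by metis
  \<comment> \<open>A diagonal entry is its own conjugate, and conjugation negates the
    \<open>e4\<close> component.\<close>
  have d: "epart (X $ i $ i) = 0" for i
  proof -
    have "epart (X $ i $ i) = - epart (X $ i $ i)"
      using *[of i i] by (simp add: ocnj_def octonion_eq_iff)
    then have "2 *\<^sub>R epart (X $ i $ i) = 0"
      by (metis eq_neg_iff_add_eq_0 scaleR_2)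
    then show ?thesis by simp
  qed
  have n: "epart (X $ 2 $ 1) = - epart (X $ 1 $ 2)" "epart (X $ 1 $ 3) = - epart (X $ 3 $ 1)"
    "epart (X $ 3 $ 2) = - epart (X $ 2 $ 3)"
    using *[of 2 1] *[of 1 3] *[of 3 2] by (simp_all add: ocnj_def)
  show "madj (hmat X) = hmat X"
    unfolding vec_eq_iff
  proof (intro allI)
    show "madj (hmat X) $ i $ j = hmat X $ i $ j" for i j
      using *[of i j] by (simp add: ocnj_def octonion_eq_iff)
  qed
  show "jcomb (hmat X) (erow X) = X"
    by (simp add: vec_eq_iff forall_3 jcomb_nth erow_nth octonion_eq_iff d n)
qed

lemma jcomb_add: "jcomb (M + N) (a + b) = jcomb M a + jcomb N b"
  by (simp add: vec_eq_iff forall_3 jcomb_nth octonion_eq_iff)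

lemma jcomb_scaleR: "jcomb (r *\<^sub>R M) (r *\<^sub>R a) = r *\<^sub>R jcomb M a"
  by (simp add: vec_eq_iff forall_3 jcomb_nth octonion_eq_iff)

lemma jcomb_eq_iff: "jcomb M a = jcomb N b \<longleftrightarrow> M = N \<and> a = b"
  by (metis erow_jcomb hmat_jcomb)

lemma qcnj_self: "qcnj x = x \<Longrightarrow> x = qre x *\<^sub>R 1"
  by (simp add: qcnj_def quat_eq_iff)

lemma qcnj_mult_add: "qcnj x * y + qcnj y * x = (2 * qre (x * qcnj y)) *\<^sub>R 1"
  by (simp add: qcnj_def quat_eq_iff quat_sel_times)

text \<open>In the coordinates \<open>M + a\<close> only associative matrix products and real traces
  remain, which makes the effect of a unitary conjugation visible.\<close>

lemma jordan_jcomb: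
  assumes M: "madj M = M" and N: "madj N = N"
  shows "jcomb M a \<circ>\<^sub>J jcomb N b = jcomb
    ((1/2) *\<^sub>R (M ** N + N ** M - (madj a ** b + madj b ** a)) + rtr (a ** madj b) *\<^sub>R mat 1)
    ((1/2) *\<^sub>R (rtr M *\<^sub>R b - b ** M + (rtr N *\<^sub>R a - a ** N)))"
proof -
  have Mc: "qcnj (M $ j $ i) = M $ i $ j" and Nc: "qcnj (N $ j $ i) = N $ i $ j" for i j
    using M N by (metis madj_nth)+
  have m: "M $ i $ i = qre (M $ i $ i) *\<^sub>R 1" and n: "N $ i $ i = qre (N $ i $ i) *\<^sub>R 1" for i
    using qcnj_self[OF Mc] qcnj_self[OF Nc] .
  obtain m1 m2 m3 where m: "M $ 1 $ 1 = m1 *\<^sub>R 1" "M $ 2 $ 2 = m2 *\<^sub>R 1" "M $ 3 $ 3 = m3 *\<^sub>R 1"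
    using m by blast
  obtain n1 n2 n3 where n: "N $ 1 $ 1 = n1 *\<^sub>R 1" "N $ 2 $ 2 = n2 *\<^sub>R 1" "N $ 3 $ 3 = n3 *\<^sub>R 1"
    using n by blast
  \<comment> \<open>The \<open>e4\<close> components contribute to a diagonal entry of the product
    through two of the three indices only: this full sum minus the index removed by
    \<open>madj a ** b + madj b ** a\<close>.\<close>
  have t: "(2 * rtr (a ** madj b)) *\<^sub>R 1 =
     (qcnj (a$1$1) * b$1$1 + qcnj (b$1$1) * a$1$1 + (qcnj (a$1$2) * b$1$2 + qcnj (b$1$2) * a$1$2)
      + (qcnj (a$1$3) * b$1$3 + qcnj (b$1$3) * a$1$3))"
    unfolding qcnj_mult_add by (simp add: rtr_def qmat_mult_nth sum_3 sum_1 flip: scaleR_add_left)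
  have tM: "rtr M = m1 + m2 + m3" and tN: "rtr N = n1 + n2 + n3"
    by (simp_all add: rtr_def sum_3 m n)
  let ?X = "jcomb M a" and ?Y = "jcomb N b"
  define J where "J = omult ?X ?Y + omult ?Y ?X"
  note e = J_def omult_def sum_3 jcomb_nth times_octonion_def
  have J: "?X \<circ>\<^sub>J ?Y = (1/2) *\<^sub>R J" by (simp add: jordan_def J_def)
  \<comment> \<open>An element of \<open>JJ\<close> is determined by its \<open>hmat\<close> and
    \<open>erow\<close>, which are then computed separately.\<close>
  have "J = 2 *\<^sub>R (?X \<circ>\<^sub>J ?Y)" by (simp add: J)
  then have "J \<in> JJ"
    using JJ_scaleR[OF JJ_jordan[OF jcomb_in_JJ[OF M] jcomb_in_JJ[OF N]]] by metis
  moreover have "hmat J = M ** N + N ** M - (madj a ** b + madj b ** a) + (2 * rtr (a ** madj b)) *\<^sub>R mat 1"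
    unfolding vec_eq_iff forall_3
    by (simp add: e qmat_mult_nth sum_1 t mat_def m n Mc Nc)
  moreover have "erow J = rtr M *\<^sub>R b - b ** M + (rtr N *\<^sub>R a - a ** N)"
    unfolding vec_eq_iff forall_3 forall_1
    by (simp add: e erow_nth tM tN qmat_mult_nth Mc Nc m n algebra_simps)
  ultimately have "J = jcomb
      (M ** N + N ** M - (madj a ** b + madj b ** a) + (2 * rtr (a ** madj b)) *\<^sub>R mat 1)
      (rtr M *\<^sub>R b - b ** M + (rtr N *\<^sub>R a - a ** N))"
    using jcomb_hmat_erow by metis
  then show ?thesis
    unfolding J by (simp add: scaleR_add_right flip: jcomb_scaleR)
qed

text \<open>Taken for arbitrary \<open>A\<close>: composition needs no unitarity, and the
  automorphism property covers all of Sp(3). The block form enters only with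
  \<open>blk\<close>.\<close>

definition phi :: "quat^1^1 \<Rightarrow> quat^3^3 \<Rightarrow> octonion^3^3 \<Rightarrow> octonion^3^3" where
  "phi p A X = jcomb (A ** hmat X ** madj A) (p ** erow X ** madj A)"

lemma phi_jcomb: "phi p A (jcomb M a) = jcomb (A ** M ** madj A) (p ** a ** madj A)"
  by (simp add: phi_def)

lemma madj_conj: "madj M = M \<Longrightarrow> madj (A ** M ** madj A) = A ** M ** madj A"
  by (simp add: madj_mult matrix_mul_assoc)

lemma phi_in_JJ: "X \<in> JJ \<Longrightarrow> phi p A X \<in> JJ"
  by (simp add: phi_def jcomb_in_JJ madj_conj madj_hmat)

lemma phi_phi: "phi p A (phi q B X) = phi (p ** q) (A ** B) X"
  by (simp add: phi_def madj_mult matrix_mul_assoc)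

lemma phi_mat_1: "X \<in> JJ \<Longrightarrow> phi (mat 1) (mat 1) X = X"
  by (simp add: phi_def jcomb_hmat_erow)

lemma hmat_linear [simp]: "hmat (X + Y) = hmat X + hmat Y" "hmat (r *\<^sub>R X) = r *\<^sub>R hmat X"
  by (simp_all add: vec_eq_iff)

lemma erow_linear [simp]: "erow (X + Y) = erow X + erow Y" "erow (r *\<^sub>R X) = r *\<^sub>R erow X"
  by (simp_all add: vec_eq_iff forall_3 erow_nth)

lemma phi_add: "phi p A (X + Y) = phi p A X + phi p A Y"
  by (simp add: phi_def qmat_simps matrix_add_ldistrib jcomb_add)

lemma phi_scaleR: "phi p A (r *\<^sub>R X) = r *\<^sub>R phi p A X"
  by (simp add: phi_def qmat_simps jcomb_scaleR)

text \<open>In \<open>jordan_jcomb\<close> the inner factors \<open>madj A ** A\<close> and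
  \<open>madj p ** p\<close> cancel, the real traces are invariant by cyclicity, and
  \<open>A ** madj A = mat 1\<close> preserves the scalar matrix.\<close>

lemma phi_jordan:
  assumes p: "madj p ** p = mat 1" and A: "madj A ** A = mat 1" "A ** madj A = mat 1"
    and X: "X \<in> JJ" and Y: "Y \<in> JJ"
  shows "phi p A (X \<circ>\<^sub>J Y) = phi p A X \<circ>\<^sub>J phi p A Y"
proof -
  define M a N b where "M = hmat X" "a = erow X" "N = hmat Y" "b = erow Y"
  then have M: "madj M = M" and N: "madj N = N" and XY: "X = jcomb M a" "Y = jcomb N b"
    using X Y by (simp_all add: madj_hmat jcomb_hmat_erow)
  have A': "U ** madj A ** A = U" for U :: "quat^3^'k"
    by (simp add: A flip: matrix_mul_assoc)
  have p': "U ** madj p ** p = U" for U :: "quat^1^'k"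
    by (simp add: p flip: matrix_mul_assoc)
  have "rtr (p ** (a ** madj b ** madj p)) = rtr (a ** madj b)"
    by (subst rtr_commute) (simp add: p')
  moreover have "rtr (A ** (M ** madj A)) = rtr M" "rtr (A ** (N ** madj A)) = rtr N"
    by (subst rtr_commute, simp add: A')+
  ultimately show ?thesis
    by (simp add: XY phi_jcomb jordan_jcomb M N madj_conj jcomb_eq_iff qmat_simps matrix_add_ldistrib
        madj_mult matrix_mul_assoc A' p' A)
qed

section \<open>The homomorphism from $Sp(1)\times Sp(1)\times Sp(2)$\<close>

definition blk :: "quat^1^1 \<Rightarrow> quat^2^2 \<Rightarrow> quat^3^3" where
  "blk q B = vector
     [vector [q$1$1, 0, 0], vector [0, B$1$1, B$1$2], vector [0, B$2$1, B$2$2]]"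

lemma blk_nth:
  "blk q B $ 1 $ 1 = q$1$1" "blk q B $ 1 $ 2 = 0" "blk q B $ 1 $ 3 = 0"
  "blk q B $ 2 $ 1 = 0" "blk q B $ 2 $ 2 = B$1$1" "blk q B $ 2 $ 3 = B$1$2"
  "blk q B $ 3 $ 1 = 0" "blk q B $ 3 $ 2 = B$2$1" "blk q B $ 3 $ 3 = B$2$2"
  by (simp_all add: blk_def)

lemma blk_mult: "blk q B ** blk r C = blk (q ** r) (B ** C)"
  by (simp add: vec_eq_iff forall_3 blk_nth qmat_mult_nth sum_3 sum_2 sum_1)

lemma madj_blk: "madj (blk q B) = blk (madj q) (madj B)"
  by (simp add: vec_eq_iff forall_3 blk_nth)

lemma blk_mat_1: "blk (mat 1) (mat 1) = mat 1"
  by (simp add: vec_eq_iff forall_3 blk_nth mat_def)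

lemma blk_eq_iff: "blk q B = blk r C \<longleftrightarrow> q = r \<and> B = C"
  by (auto simp: vec_eq_iff forall_3 forall_2 forall_1 blk_nth)

lemma blk_minus: "blk (- q) (- B) = - blk q B"
  by (simp add: vec_eq_iff forall_3 blk_nth)

lemma Sp_simps: "A \<in> carrier Sp \<longleftrightarrow> A ** madj A = mat 1 \<and> madj A ** A = mat 1"
  "A \<otimes>\<^bsub>Sp\<^esub> B = A ** B" "\<one>\<^bsub>Sp\<^esub> = mat 1"
  by (auto simp: Sp_def qadjoint_eq_madj)

text \<open>Restricted to \<open>JJ\<close> because members of \<open>Bij JJ\<close> are extensional
  functions.\<close>

definition Phi :: "(quat^1^1) \<times> (quat^1^1) \<times> (quat^2^2) \<Rightarrow> octonion^3^3 \<Rightarrow> octonion^3^3" where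
  "Phi = (\<lambda>(p, q, B). restrict (phi p (blk q B)) JJ)"

lemma Phi_apply: "X \<in> JJ \<Longrightarrow> Phi (p, q, B) X = phi p (blk q B) X"
  by (simp add: Phi_def)

lemma Sp112_simps:
  "(p, q, B) \<in> carrier Sp112 \<longleftrightarrow> p \<in> carrier Sp \<and> q \<in> carrier Sp \<and> B \<in> carrier Sp"
  "(p, q, B) \<otimes>\<^bsub>Sp112\<^esub> (p', q', B') = (p ** p', q ** q', B ** B')"
  "\<one>\<^bsub>Sp112\<^esub> = (mat 1, mat 1, mat 1)"
  by (simp_all add: Sp112_def Sp_simps)

lemma Phi_mult:
  assumes "X \<in> JJ"
  shows "Phi g (Phi h X) = Phi (g \<otimes>\<^bsub>Sp112\<^esub> h) X"
  using assms
  by (cases g; cases h) (simp add: Phi_apply phi_in_JJ phi_phi blk_mult Sp112_simps)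

lemma Phi_one: "X \<in> JJ \<Longrightarrow> Phi \<one>\<^bsub>Sp112\<^esub> X = X"
  by (simp add: Sp112_simps Phi_apply blk_mat_1 phi_mat_1)

lemma Phi_in_JJ: "X \<in> JJ \<Longrightarrow> Phi g X \<in> JJ"
  by (cases g) (simp add: Phi_apply phi_in_JJ)

lemma Phi_in_F4:
  assumes g: "g \<in> carrier Sp112"
  shows "Phi g \<in> F4_set"
proof -
  interpret group Sp112 by (rule group_Sp112)
  obtain p q B where pqB: "g = (p, q, B)" by (cases g)
  have sp: "madj p ** p = mat 1" "blk q B ** madj (blk q B) = mat 1"
    "madj (blk q B) ** blk q B = mat 1"
    using g by (simp_all add: pqB Sp112_simps Sp_simps madj_blk blk_mult blk_mat_1)
  have "bij_betw (Phi g) JJ JJ"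
    by (rule bij_betw_byWitness[where f' = "Phi (inv\<^bsub>Sp112\<^esub> g)"])
      (auto simp: Phi_mult Phi_in_JJ g Phi_one)
  then have "Phi g \<in> Bij JJ"
    by (simp add: Bij_def Phi_def pqB)
  then show ?thesis
    using sp by (simp add: F4_set_def pqB Phi_apply JJ_add JJ_scaleR JJ_jordan phi_add phi_scaleR
      phi_jordan)
qed

text \<open>Both involutions come from central elements of \<open>Sp112\<close>, so \<open>Phi\<close> maps into their centralizer.\<close>

lemma jsigma_eq_Phi: "jsigma = Phi (mat 1, mat 1, - mat 1)"
proof
  fix X
  show "jsigma X = Phi (mat 1, mat 1, - mat 1) X"
  proof (cases "X \<in> JJ")
    case True
    then obtain M a where X: "X = jcomb M a" using jcomb_hmat_erow by metis
    show ?thesis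
      unfolding Phi_apply[OF True] vec_eq_iff forall_3 jsigma_nth[OF True]
      by (simp add: X phi_jcomb jcomb_nth qmat_mult_nth sum_3 sum_1 blk_nth mat_def
        octonion_eq_iff jsign_def)
  qed (simp add: jsigma_def Phi_def)
qed

lemma jgamma_eq_Phi: "jgamma = Phi (- mat 1, mat 1, mat 1)"
proof
  fix X
  show "jgamma X = Phi (- mat 1, mat 1, mat 1) X"
  proof (cases "X \<in> JJ")
    case True
    then obtain M a where X: "X = jcomb M a" using jcomb_hmat_erow by metis
    show ?thesis
      unfolding Phi_apply[OF True] vec_eq_iff forall_3 jgamma_nth[OF True]
      by (simp add: X phi_jcomb jcomb_nth blk_mat_1 qmat_simps octonion_eq_iff ogamma_def)
  qed (simp add: jgamma_def Phi_def)
qed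

lemma F4_mult_Phi:
  assumes "g \<in> carrier Sp112" "h \<in> carrier Sp112"
  shows "Phi g \<otimes>\<^bsub>F4\<^esub> Phi h = Phi (g \<otimes>\<^bsub>Sp112\<^esub> h)"
proof
  fix X
  have "\<exists>f. Phi (g \<otimes>\<^bsub>Sp112\<^esub> h) = restrict f JJ"
    by (cases "g \<otimes>\<^bsub>Sp112\<^esub> h") (auto simp: Phi_def)
  then show "(Phi g \<otimes>\<^bsub>F4\<^esub> Phi h) X = Phi (g \<otimes>\<^bsub>Sp112\<^esub> h) X"
    using assms by (cases "X \<in> JJ") (auto simp: mult_F4 Phi_in_F4 compose_def Phi_mult)
qed

lemma Phi_group_hom: "group_hom Sp112 F4_sigma_gamma Phi"
proof (intro group_hom.intro group_hom_axioms.intro group_Sp112 group_F4_sigma_gamma homI)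
  fix g assume g: "g \<in> carrier Sp112"
  have z: "(mat 1, mat 1, - mat 1) \<in> carrier Sp112" "(- mat 1, mat 1, mat 1) \<in> carrier Sp112"
    by (simp_all add: Sp112_simps Sp_simps qmat_simps)
  have "z \<otimes>\<^bsub>Sp112\<^esub> g = g \<otimes>\<^bsub>Sp112\<^esub> z" if "z \<in> {(mat 1, mat 1, - mat 1), (- mat 1, mat 1, mat 1)}" for z
    using that by (cases g) (auto simp: Sp112_simps qmat_simps)
  then show "Phi g \<in> carrier F4_sigma_gamma"
    using g z by (simp add: F4_sigma_gamma_def Phi_in_F4 jsigma_eq_Phi jgamma_eq_Phi F4_mult_Phi)
next
  fix g h assume "g \<in> carrier Sp112" "h \<in> carrier Sp112"
  then show "Phi (g \<otimes>\<^bsub>Sp112\<^esub> h) = Phi g \<otimes>\<^bsub>F4_sigma_gamma\<^esub> Phi h"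
    by (simp add: F4_sigma_gamma_def F4_mult_Phi)
qed

section \<open>The kernel of the homomorphism\<close>

lemma quat_central_real:
  fixes p :: quat
  assumes "\<And>x. p * x = x * p"
  shows "p = qre p *\<^sub>R 1"
  \<comment> \<open>Commuting with \<open>i\<close> kills the \<open>j\<close> and \<open>k\<close>
    components, commuting with \<open>j\<close> the \<open>i\<close> component.\<close>
  using assms[of "Quat 0 1 0 0"] assms[of "Quat 0 0 1 0"]
  by (simp add: quat_eq_iff quat_sel_times)

text \<open>The action on row vectors suffices. Its first coordinate forces \<open>p = q\<close> to
  be central of norm one, hence a sign; the unit rows then show that \<open>A\<close> is the same
  sign.\<close>

lemma kernel_Phi: "kernel Sp112 F4_sigma_gamma Phi = Z2"
proof
  have one: "\<one>\<^bsub>F4_sigma_gamma\<^esub> = (\<lambda>X\<in>JJ. X)"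
    by (simp add: F4_sigma_gamma_def one_F4)
  show "Z2 \<subseteq> kernel Sp112 F4_sigma_gamma Phi"
  proof
    fix g assume g: "g \<in> Z2"
    then have "Phi g X = X" if "X \<in> JJ" for X
      using that Phi_one[OF that]
      by (auto simp: Z2_def Phi_apply Sp112_simps blk_minus phi_def qmat_simps)
    moreover have "\<exists>f. Phi g = restrict f JJ" by (cases g) (auto simp: Phi_def)
    ultimately have "Phi g = (\<lambda>X\<in>JJ. X)" by (auto simp: fun_eq_iff)
    moreover have "g \<in> carrier Sp112"
      using g by (auto simp: Z2_def Sp112_simps Sp_simps qmat_simps)
    ultimately show "g \<in> kernel Sp112 F4_sigma_gamma Phi" by (simp add: kernel_def one)
  qed
  show "kernel Sp112 F4_sigma_gamma Phi \<subseteq> Z2"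
  proof
    fix g assume "g \<in> kernel Sp112 F4_sigma_gamma Phi"
    then have g: "g \<in> carrier Sp112" "Phi g = (\<lambda>X\<in>JJ. X)" by (simp_all add: kernel_def one)
    obtain p q B where pqB: "g = (p, q, B)" by (cases g)
    define A where "A = blk q B"
    have id: "p ** a ** madj A = a" for a
    proof -
      have "Phi g (jcomb 0 a) = jcomb 0 a" by (simp add: g jcomb_in_JJ)
      then show ?thesis
        by (simp add: pqB Phi_apply jcomb_in_JJ phi_jcomb jcomb_eq_iff A_def)
    qed
    have pq: "p$1$1 * x * qcnj (q$1$1) = x" for x
    proof -
      have "(p ** (\<chi> i j. if j = 1 then x else 0) ** madj A) $ 1 $ 1 = x" by (simp add: id)
      then show ?thesis by (simp add: qmat_mult_nth sum_3 sum_1 A_def blk_nth)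
    qed
    have u: "q$1$1 * qcnj (q$1$1) = 1" "qcnj (q$1$1) * q$1$1 = 1" "p$1$1 * qcnj (p$1$1) = 1"
      using g(1) by (simp_all add: pqB Sp112_simps Sp_simps vec_eq_iff qmat_mult_nth sum_1 mat_def)
    have "p$1$1 = q$1$1"
      using arg_cong[OF pq[of 1], of "\<lambda>y. y * q$1$1"] by (simp add: mult.assoc u)
    then have "p$1$1 * x = x * p$1$1" for x
      using arg_cong[OF pq[of x], of "\<lambda>y. y * q$1$1"] by (simp add: mult.assoc u)
    then obtain r where r: "p$1$1 = r *\<^sub>R 1"
      using quat_central_real by blast
    have "r * r = 1"
      using arg_cong[OF u(3), of qre] by (simp add: r)
    then have "r = 1 \<or> r = - 1"
      by (simp add: square_eq_1_iff)
    then have p: "p = mat 1 \<or> p = - mat 1"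
      using r by (auto simp: vec_eq_iff mat_def forall_1)
    have "a ** A = p ** a" for a
    proof -
      have "madj A ** A = mat 1"
        using g(1) by (simp add: A_def pqB Sp112_simps Sp_simps madj_blk blk_mult blk_mat_1)
      then show ?thesis using id[of a] by (metis matrix_mul_assoc matrix_mul_rid)
    qed
    then have A: "(a ** A) $ 1 $ j = (p ** a) $ 1 $ j" for a j by simp
    have "A $ i $ j = p$1$1 * mat 1 $ i $ j" for i j
    proof -
      \<comment> \<open>The row vector is row \<open>i\<close> of the identity, so multiplying by
        \<open>A\<close> reads off row \<open>i\<close> of \<open>A\<close>.\<close>
      have "((\<chi> k. mat 1 $ i) ** A :: quat^3^1) $ 1 $ j = (mat 1 ** A) $ i $ j"
        by (simp only: qmat_mult_nth vec_lambda_beta)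
      then show ?thesis
        unfolding A by (simp add: qmat_mult_nth sum_1)
    qed
    then have "A = mat 1 \<and> p = mat 1 \<or> A = - mat 1 \<and> p = - mat 1"
      using p by (auto simp: vec_eq_iff mat_def)
    then show "g \<in> Z2"
      unfolding A_def
      by (auto simp: Z2_def pqB blk_eq_iff simp flip: blk_mat_1 blk_minus)
  qed
qed

section \<open>Surjectivity\<close>

lemma quat_norm_mult_qcnj:
  fixes x :: quat
  shows "x * qcnj x = (norm x)\<^sup>2 *\<^sub>R 1" "qcnj x * x = (norm x)\<^sup>2 *\<^sub>R 1"
  unfolding power2_norm_eq_inner
  by (simp_all add: quat_eq_iff quat_sel_times qcnj_def inner_quat_def)

lemma quat_mult_eq_0_iff:
  fixes x y :: quat
  shows "x * y = 0 \<longleftrightarrow> x = 0 \<or> y = 0"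
proof
  assume "x * y = 0"
  then have "qcnj x * x * y = 0" by (simp add: mult.assoc)
  then show "x = 0 \<or> y = 0" by (simp add: quat_norm_mult_qcnj)
qed auto

text \<open>Skolem-Noether for the quaternions: a nonzero intertwiner, scaled to norm one, is the
  conjugating element.\<close>

lemma quat_automorphism_inner:
  assumes lin: "linear f" and mult: "\<And>x y. f (x * y) = f x * f y" and one: "f 1 = (1::quat)"
  obtains r where "r * qcnj r = 1" "qcnj r * r = 1" "\<And>x. f x = r * x * qcnj r"
proof -
  define i j k where ijk: "i = Quat 0 1 0 0" "j = Quat 0 0 1 0" "k = Quat 0 0 0 1"
  have t: "i * i = - 1" "j * j = - 1" "k * k = - 1" "i * j = k" "j * k = i" "k * i = j"
    "j * i = - k" "k * j = - i" "i * k = - j"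
    by (simp_all add: ijk quat_eq_iff quat_sel_times)
  have neg: "f (- x) = - f x" for x by (rule linear_neg[OF lin])
  have ft: "f i * f i = - 1" "f j * f j = - 1" "f k * f k = - 1" "f i * f j = f k"
    "f j * f k = f i" "f k * f i = f j" "f j * f i = - f k" "f k * f j = - f i" "f i * f k = - f j"
    by (simp_all flip: mult add: t neg one)
  have ft': "f i * (f i * x) = - x" "f j * (f j * x) = - x" "f k * (f k * x) = - x"
    "f i * (f j * x) = f k * x" "f j * (f k * x) = f i * x" "f k * (f i * x) = f j * x"
    "f j * (f i * x) = - (f k * x)" "f k * (f j * x) = - (f i * x)" "f i * (f k * x) = - (f j * x)"
    for x
    by (simp_all add: ft flip: mult.assoc)
  \<comment> \<open>averaging over the quaternion group gives intertwiners: \<open>f y * s x = s x * y\<close>\<close>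
  define s where "s x = x - f i * x * i - f j * x * j - f k * x * k" for x
  have com: "f i * s x = s x * i" "f j * s x = s x * j" "f k * s x = s x * k" for x
    by (simp_all add: s_def algebra_simps t ft' flip: mult.assoc) (simp_all add: mult.assoc t ft')
  \<comment> \<open>All terms containing \<open>f\<close> cancel, leaving 4, so the averages cannot
    all vanish.\<close>
  have "s 1 - s i * i - s j * j - s k * k = 4"
    by (simp add: s_def algebra_simps t)
  then have "\<exists>x. s x \<noteq> 0"
    by (metis diff_self mult_zero_left zero_neq_numeral)
  then obtain x where x: "s x \<noteq> 0" by blast
  have dec: "y = qre y *\<^sub>R 1 + qi y *\<^sub>R i + qj y *\<^sub>R j + qk y *\<^sub>R k" for y
    by (simp add: quat_eq_iff ijk)
  have fs: "f y * s x = s x * y" for y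
  proof -
    have "f y = qre y *\<^sub>R 1 + qi y *\<^sub>R f i + qj y *\<^sub>R f j + qk y *\<^sub>R f k"
      by (subst dec[of y]) (simp add: linear_add[OF lin] linear_cmul[OF lin] one)
    then show ?thesis
      by (subst (2) dec[of y]) (simp add: distrib_left distrib_right com)
  qed
  define r where "r = (1 / norm (s x)) *\<^sub>R s x"
  have r: "r * qcnj r = 1" "qcnj r * r = 1"
    using x by (simp_all add: r_def quat_norm_mult_qcnj power2_eq_square)
  have "f y * r = r * y" for y by (simp add: r_def fs)
  then have "f y = r * y * qcnj r" for y
    using r(1) by (metis mult.assoc mult.right_neutral)
  with r show thesis by (rule that)
qed

section \<open>Octonion identities and the Jordan product in coordinates\<close>

lemma octonion_one [simp]: "1 * x = x" "x * 1 = (x::octonion)"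
  by (simp_all add: times_octonion_def octonion_eq_iff)

lemma ocnj_one [simp]: "ocnj 1 = 1"
  by (simp add: ocnj_def octonion_eq_iff)

lemma octonion_zero_mult [simp]: "0 * x = 0" "x * 0 = (0::octonion)"
  by (simp_all add: times_octonion_def octonion_eq_iff)

text \<open>In this form conjugation visibly commutes with every linear isometry fixing 1.\<close>

lemma ocnj_eq_inner: "ocnj x = (2 * inner x 1) *\<^sub>R 1 - x"
  by (simp add: ocnj_def octonion_eq_iff quat_eq_iff qcnj_def inner_octonion_def inner_quat_def)

lemma ocnj_mult_add: "x * ocnj y + y * ocnj x = (2 * inner x y) *\<^sub>R 1"
  "ocnj x * y + ocnj y * x = (2 * inner x y) *\<^sub>R 1"
  by (simp_all add: ocnj_def octonion_eq_iff quat_eq_iff qcnj_def inner_octonion_def inner_quat_def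
      times_octonion_def quat_sel_times)

lemma jmat_eq_iff: "jmat a b c x y z = jmat a' b' c' x' y' z' \<longleftrightarrow>
  a = a' \<and> b = b' \<and> c = c' \<and> x = x' \<and> y = y' \<and> z = z'"
proof
  assume e: "jmat a b c x y z = jmat a' b' c' x' y' z'"
  have "jmat a b c x y z $ i $ j = jmat a' b' c' x' y' z' $ i $ j" for i j
    by (simp add: e)
  from this[of 1 1] this[of 2 2] this[of 3 3] this[of 2 3] this[of 3 1] this[of 1 2]
  show "a = a' \<and> b = b' \<and> c = c' \<and> x = x' \<and> y = y' \<and> z = z'"
    by (simp add: jmat_nth octonion_eq_iff quat_eq_iff)
qed auto

lemma jmat_linear:
  "jmat a b c x y z + jmat a' b' c' x' y' z' = jmat (a+a') (b+b') (c+c') (x+x') (y+y') (z+z')"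
  "r *\<^sub>R jmat a b c x y z = jmat (r*a) (r*b) (r*c) (r *\<^sub>R x) (r *\<^sub>R y) (r *\<^sub>R z)"
  by (simp_all add: vec_eq_iff forall_3 jmat_nth scaleR_add_left)

lemma jordan_jmat:
  "jmat a b c x y z \<circ>\<^sub>J jmat a' b' c' x' y' z' = jmat
    (a * a' + inner y y' + inner z z') (b * b' + inner x x' + inner z z')
    (c * c' + inner x x' + inner y y')
    ((1/2) *\<^sub>R ((b + c) *\<^sub>R x' + (b' + c') *\<^sub>R x + ocnj (y * z') + ocnj (y' * z)))
    ((1/2) *\<^sub>R ((a + c) *\<^sub>R y' + (a' + c') *\<^sub>R y + ocnj (z * x') + ocnj (z' * x)))
    ((1/2) *\<^sub>R ((a + b) *\<^sub>R z' + (a' + b') *\<^sub>R z + ocnj (x * y') + ocnj (x' * y)))"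
    (is "_ = ?R")
proof -
  have e: "u * ocnj v + (v * ocnj u + w) = (inner u v * 2) *\<^sub>R 1 + w"
    "ocnj u * v + (ocnj v * u + w) = (inner u v * 2) *\<^sub>R 1 + w"
    "(k * (l * 2)) *\<^sub>R 1 = (k * l) *\<^sub>R 1 + (k * l) *\<^sub>R (1 :: octonion)"
    for u v w k l
    by (simp_all add: ocnj_mult_add mult.commute flip: add.assoc scaleR_add_left)
  \<comment> \<open>Doubling clears the factor 1/2; mixed products on the diagonal then pair up by
    \<open>ocnj_mult_add\<close>.\<close>
  have "2 *\<^sub>R (jmat a b c x y z \<circ>\<^sub>J jmat a' b' c' x' y' z') = 2 *\<^sub>R ?R"
    unfolding jmat_linear vec_eq_iff forall_3
    by (simp add: jordan_def omult_def sum_3 jmat_nth octonion_scaleR_mult ocnj_mult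
        algebra_simps) (simp add: e add_ac)
  then show ?thesis by simp
qed

lemma jmat_zero: "jmat 0 0 0 0 0 0 = 0"
  by (simp add: vec_eq_iff forall_3 jmat_nth)

lemma octonion_inner_one [simp]: "inner 1 (1::octonion) = 1"
  by (simp add: inner_octonion_def inner_quat_def)

lemma inner_Oct: "inner (Oct m a) (Oct n b) = inner m n + inner a b"
  by (simp add: inner_octonion_def)

lemma quat_inner_self: "inner x x *\<^sub>R 1 = x * qcnj x" "inner x x *\<^sub>R 1 = qcnj x * (x :: quat)"
  by (simp_all add: quat_norm_mult_qcnj power2_norm_eq_inner)

lemma inner_qcnj [simp]: "inner (qcnj x) (qcnj y) = inner x y"
  by (simp add: inner_quat_def qcnj_def)

text \<open>Applied twice: to the given \<beta> and to the element \<gamma> left after dividing by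
  an element of Sp(2).\<close>

locale centralizing =
  fixes \<beta>
  assumes \<beta>: "\<beta> \<in> carrier F4_sigma_gamma"
begin

lemma F4: "\<beta> \<in> F4_set"
  using \<beta> by (simp add: F4_sigma_gamma_def)

lemma in_JJ: "X \<in> JJ \<Longrightarrow> \<beta> X \<in> JJ"
  using F4 by (auto simp: F4_set_def Bij_def bij_betw_def)

lemma inj: "X \<in> JJ \<Longrightarrow> Y \<in> JJ \<Longrightarrow> \<beta> X = \<beta> Y \<longleftrightarrow> X = Y"
  using F4 by (auto simp: F4_set_def Bij_def bij_betw_def inj_on_def)

lemma add: "X \<in> JJ \<Longrightarrow> Y \<in> JJ \<Longrightarrow> \<beta> (X + Y) = \<beta> X + \<beta> Y"
  and scaleR: "X \<in> JJ \<Longrightarrow> \<beta> (r *\<^sub>R X) = r *\<^sub>R \<beta> X"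
  and jordan: "X \<in> JJ \<Longrightarrow> Y \<in> JJ \<Longrightarrow> \<beta> (X \<circ>\<^sub>J Y) = \<beta> X \<circ>\<^sub>J \<beta> Y"
  using F4 by (auto simp: F4_set_def)

lemma jsigma: "X \<in> JJ \<Longrightarrow> \<beta> (jsigma X) = jsigma (\<beta> X)"
  and jgamma: "X \<in> JJ \<Longrightarrow> \<beta> (jgamma X) = jgamma (\<beta> X)"
proof -
  have *: "compose JJ \<beta> jsigma = compose JJ jsigma \<beta>" "compose JJ \<beta> jgamma = compose JJ jgamma \<beta>"
    using \<beta> by (simp_all add: F4_sigma_gamma_def mult_F4 F4 jsigma_in_F4 jgamma_in_F4)
  show "X \<in> JJ \<Longrightarrow> \<beta> (jsigma X) = jsigma (\<beta> X)" "X \<in> JJ \<Longrightarrow> \<beta> (jgamma X) = jgamma (\<beta> X)"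
    using fun_cong[OF *(1), of X] fun_cong[OF *(2), of X] by (simp_all add: compose_def)
qed

lemma jmat_ex:
  assumes "X \<in> JJ" obtains a b c x y z where "\<beta> X = jmat a b c x y z"
  using jmat_expand[OF in_JJ[OF assms]] by metis

text \<open>The source is fixed by \<open>jgamma\<close> and negated by \<open>jsigma\<close>, so
  its image is too. The conjugate on \<open>d\<close> makes \<open>c, d\<close> the last two entries
  of the first row.\<close>

lemma off_diagonal_image:
  obtains c d where "\<beta> (jmat 0 0 0 0 (Oct m 0) (Oct n 0)) = jmat 0 0 0 0 (Oct (qcnj d) 0) (Oct c 0)"
proof -
  let ?X = "jmat 0 0 0 0 (Oct m 0) (Oct n 0)"
  obtain a b c x y z where X: "\<beta> ?X = jmat a b c x y z" by (rule jmat_ex[OF jmat_in_JJ])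
  have "jgamma ?X = ?X" by (simp add: jgamma_jmat ogamma_def octonion_eq_iff jmat_eq_iff)
  then have g: "jmat a b c (ogamma x) (ogamma y) (ogamma z) = jmat a b c x y z"
    using jgamma[OF jmat_in_JJ, of 0 0 0 0 "Oct m 0" "Oct n 0"] by (simp add: X jgamma_jmat)
  \<comment> \<open>Negation is written as a scalar multiple so that \<open>scaleR\<close> moves it
    through \<beta>.\<close>
  have X': "jsigma ?X = (- 1) *\<^sub>R ?X" by (simp add: jsigma_jmat jmat_linear del: scaleR_minus1_left)
  have "jmat a b c x (- y) (- z) = jsigma (\<beta> ?X)"
    by (simp only: X jsigma_jmat)
  also have "\<dots> = \<beta> ((- 1) *\<^sub>R ?X)"
    unfolding X'[symmetric] by (rule jsigma[OF jmat_in_JJ, symmetric])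
  also have "\<dots> = (- 1) *\<^sub>R \<beta> ?X"
    by (rule scaleR[OF jmat_in_JJ])
  finally have "jmat a b c x (- y) (- z) = (- 1) *\<^sub>R jmat a b c x y z"
    unfolding X .
  then have "a = 0" "b = 0" "c = 0" "x = 0" "epart y = 0" "epart z = 0"
    using g unfolding jmat_linear jmat_eq_iff
    by (auto simp: ogamma_def octonion_eq_iff quat_eq_iff)
  then show thesis
    using that[of "qcnj (hpart y)" "hpart z"] by (cases y; cases z) (simp add: X)
qed

text \<open>With \<open>P = F\<^sub>3(1)\<close> and \<open>Q = F\<^sub>2(1)\<close>, the relation \<open>P\<^sup>2 P = P\<close> makes the rows \<open>c\<close> and \<open>d\<close> unit
  vectors and \<open>P\<^sup>2 Q = Q / 2\<close> makes them orthogonal, so they are the rows of a matrix in \<open>Sp(2)\<close>.\<close>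

lemma unit_vectors_image:
  obtains c1 c2 d1 d2 where
    "\<beta> (jmat 0 0 0 0 0 1) = jmat 0 0 0 0 (Oct (qcnj c2) 0) (Oct c1 0)"
    "\<beta> (jmat 0 0 0 0 1 0) = jmat 0 0 0 0 (Oct (qcnj d2) 0) (Oct d1 0)"
    "c1 * qcnj c1 + c2 * qcnj c2 = 1" "d1 * qcnj d1 + d2 * qcnj d2 = 1"
    "d1 * qcnj c1 + d2 * qcnj c2 = 0"
proof -
  let ?P = "jmat 0 0 0 0 0 1" and ?Q = "jmat 0 0 0 0 1 0"
  \<comment> \<open>The cube of an element with quaternions \<open>y, z\<close> in these places is
    \<open>inner y y + inner z z\<close> times the element. It is also the element itself, which is
    nonzero by injectivity, so the scalar is 1.\<close>
  have unit: "inner y y + inner z z = 1"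
    if X: "X \<in> JJ" "X \<circ>\<^sub>J X \<circ>\<^sub>J X = X" "X \<noteq> 0"
      and \<beta>X: "\<beta> X = jmat 0 0 0 0 (Oct y 0) (Oct z 0)" for X y z
  proof -
    have "\<beta> X \<circ>\<^sub>J \<beta> X \<circ>\<^sub>J \<beta> X = \<beta> X" using X by (metis JJ_jordan jordan)
    then have "(inner y y + inner z z) *\<^sub>R y = y" "(inner y y + inner z z) *\<^sub>R z = z"
      unfolding \<beta>X jordan_jmat jmat_eq_iff
      by (simp_all add: octonion_eq_iff quat_eq_iff ocnj_def qcnj_def inner_octonion_def inner_quat_def
          times_octonion_def quat_sel_times algebra_simps)
    moreover have "y \<noteq> 0 \<or> z \<noteq> 0"
    proof (rule ccontr)
      assume "\<not> ?thesis"
      then have "\<beta> X = 0 *\<^sub>R \<beta> X" by (simp add: \<beta>X jmat_linear octonion_eq_iff jmat_eq_iff)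
      then have "\<beta> X = \<beta> (0 *\<^sub>R X)" by (simp only: scaleR X(1))
      then show False using X by (simp add: inj JJ_scaleR del: scaleR_zero_left) simp
    qed
    ultimately show ?thesis by (metis scaleR_cancel_right scaleR_one)
  qed
  have P: "?P \<circ>\<^sub>J ?P \<circ>\<^sub>J ?P = ?P" and Q: "?Q \<circ>\<^sub>J ?Q \<circ>\<^sub>J ?Q = ?Q"
    and PQ: "?P \<circ>\<^sub>J ?P \<circ>\<^sub>J ?Q = (1/2) *\<^sub>R ?Q"
    by (simp_all add: jordan_jmat jmat_linear jmat_eq_iff)
  have nz: "?P \<noteq> 0" "?Q \<noteq> 0"
    unfolding jmat_zero[symmetric] jmat_eq_iff by (simp_all add: octonion_eq_iff)
  obtain c1 c2 where c: "\<beta> ?P = jmat 0 0 0 0 (Oct (qcnj c2) 0) (Oct c1 0)"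
    by (metis off_diagonal_image zero_octonion_def one_octonion_def)
  obtain d1 d2 where d: "\<beta> ?Q = jmat 0 0 0 0 (Oct (qcnj d2) 0) (Oct d1 0)"
    by (metis off_diagonal_image zero_octonion_def one_octonion_def)
  have cc: "inner c2 c2 + inner c1 c1 = 1" and dd: "inner d2 d2 + inner d1 d1 = 1"
    using unit[OF _ P nz(1) c] unit[OF _ Q nz(2) d] by (simp_all add: jmat_in_JJ inner_Oct)
  have "c1 * qcnj c1 + c2 * qcnj c2 = 1" "d1 * qcnj d1 + d2 * qcnj d2 = 1"
    using cc dd by (simp_all add: add.commute flip: quat_inner_self(1) scaleR_add_left)
  moreover have "d1 * qcnj c1 + d2 * qcnj c2 = 0"
  proof -
    let ?w = "d1 * qcnj c1 + d2 * qcnj c2"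
    have "\<beta> ?P \<circ>\<^sub>J \<beta> ?P \<circ>\<^sub>J \<beta> ?Q = (1/2) *\<^sub>R \<beta> ?Q"
      using PQ by (metis JJ_jordan jordan scaleR jmat_in_JJ)
    then have 1: "inner c1 c1 *\<^sub>R d1 + d2 * qcnj c2 * c1 = 0"
      and 2: "inner c2 c2 *\<^sub>R qcnj d2 + qcnj c2 * c1 * qcnj d1 = 0"
      unfolding c d jordan_jmat jmat_eq_iff jmat_linear
      by (simp_all add: inner_Oct cc scaleR_add_left octonion_eq_iff ocnj_def times_octonion_def
        qcnj_mult mult.assoc)
    \<comment> \<open>Replacing \<open>inner c c\<close> by \<open>qcnj c * c\<close> factors both
      relations as \<open>?w * c1 = 0\<close> and \<open>?w * c2 = 0\<close>.\<close>
    have "d1 * (inner c1 c1 *\<^sub>R 1) + d2 * qcnj c2 * c1 = 0"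
      using 1 by simp
    moreover have "d2 * (inner c2 c2 *\<^sub>R 1) + d1 * qcnj c1 * c2 = 0"
      using arg_cong[OF 2, of qcnj] by (simp add: qcnj_mult mult.assoc)
    ultimately have "?w * c1 = 0" "?w * c2 = 0"
      unfolding quat_inner_self(2) by (simp_all add: distrib_right mult.assoc add.commute)
    moreover have "c1 \<noteq> 0 \<or> c2 \<noteq> 0" using cc by auto
    ultimately show ?thesis by (auto simp: quat_mult_eq_0_iff)
  qed
  ultimately show thesis by (rule that[OF c d])
qed

text \<open>\<open>P\<close> and \<open>Q\<close> generate these elements: their squares are
  diag(1,1,0) and diag(1,0,1), whose product is diag(1,0,0), and twice the product of
  \<open>P\<close> and \<open>Q\<close> has \<open>x1 = 1\<close> as its only coordinate.\<close>

lemma fixes_diagonal: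
  assumes P: "\<beta> (jmat 0 0 0 0 0 1) = jmat 0 0 0 0 0 1"
    and Q: "\<beta> (jmat 0 0 0 0 1 0) = jmat 0 0 0 0 1 0"
  shows "\<beta> (jmat a b c 0 0 0) = jmat a b c 0 0 0" "\<beta> (jmat 0 0 0 1 0 0) = jmat 0 0 0 1 0 0"
proof -
  let ?P = "jmat 0 0 0 0 0 1" and ?Q = "jmat 0 0 0 0 1 0"
  have P2: "?P \<circ>\<^sub>J ?P = jmat 1 1 0 0 0 0" and Q2: "?Q \<circ>\<^sub>J ?Q = jmat 1 0 1 0 0 0"
    and PQ: "2 *\<^sub>R (?P \<circ>\<^sub>J ?Q) = jmat 0 0 0 1 0 0"
    and E: "jmat 1 1 0 0 0 0 \<circ>\<^sub>J jmat 1 0 1 0 0 0 = jmat 1 0 0 0 0 0"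
    by (simp_all add: jordan_jmat jmat_linear jmat_eq_iff)
  have 1: "\<beta> (jmat 1 1 0 0 0 0) = jmat 1 1 0 0 0 0" and 2: "\<beta> (jmat 1 0 1 0 0 0) = jmat 1 0 1 0 0 0"
    using jordan[OF jmat_in_JJ jmat_in_JJ, of 0 0 0 0 0 1 0 0 0 0 0 1]
      jordan[OF jmat_in_JJ jmat_in_JJ, of 0 0 0 0 1 0 0 0 0 0 1 0]
    by (simp_all add: P Q P2 Q2)
  have 3: "\<beta> (jmat 1 0 0 0 0 0) = jmat 1 0 0 0 0 0"
    using jordan[OF jmat_in_JJ jmat_in_JJ, of 1 1 0 0 0 0 1 0 1 0 0 0] by (simp add: 1 2 E)
  show "\<beta> (jmat 0 0 0 1 0 0) = jmat 0 0 0 1 0 0"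
    unfolding PQ[symmetric] by (simp only: scaleR JJ_jordan jordan jmat_in_JJ P Q)
  have "jmat a b c 0 0 0 = b *\<^sub>R jmat 1 1 0 0 0 0 + c *\<^sub>R jmat 1 0 1 0 0 0 + (a - b - c) *\<^sub>R jmat 1 0 0 0 0 0"
    by (simp add: jmat_linear jmat_eq_iff)
  then show "\<beta> (jmat a b c 0 0 0) = jmat a b c 0 0 0"
    by (simp only: add scaleR JJ_add JJ_scaleR jmat_in_JJ 1 2 3)
qed

text \<open>Each off-diagonal Peirce space is the common 1/2-eigenspace of multiplication by two
  diagonal idempotents. As \<beta> fixes these, it preserves the space.\<close>

lemma peirce_components:
  assumes diag: "\<And>a b c. \<beta> (jmat a b c 0 0 0) = jmat a b c 0 0 0"
  obtains f1 f2 f3 where "\<And>x. \<beta> (jmat 0 0 0 x 0 0) = jmat 0 0 0 (f1 x) 0 0"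
    "\<And>x. \<beta> (jmat 0 0 0 0 x 0) = jmat 0 0 0 0 (f2 x) 0"
    "\<And>x. \<beta> (jmat 0 0 0 0 0 x) = jmat 0 0 0 0 0 (f3 x)"
proof -
  have *: "jmat a b c 0 0 0 \<circ>\<^sub>J \<beta> X = (1/2) *\<^sub>R \<beta> X"
    if "jmat a b c 0 0 0 \<circ>\<^sub>J X = (1/2) *\<^sub>R X" "X \<in> JJ" for a b c X
    using that by (metis diag jmat_in_JJ jordan scaleR)
  have half: "(1/2) *\<^sub>R x = (0::octonion) \<longleftrightarrow> x = 0" "(0::octonion) = (1/2) *\<^sub>R x \<longleftrightarrow> x = 0" for x
    by auto
  have "\<exists>y. \<beta> (jmat 0 0 0 x 0 0) = jmat 0 0 0 y 0 0" for x
  proof -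
    obtain a b c u v w where X: "\<beta> (jmat 0 0 0 x 0 0) = jmat a b c u v w" by (rule jmat_ex[OF jmat_in_JJ])
    show ?thesis
      using *[of 0 1 0 "jmat 0 0 0 x 0 0"] *[of 0 0 1 "jmat 0 0 0 x 0 0"]
      by (simp add: X jordan_jmat jmat_linear jmat_eq_iff jmat_in_JJ half)
  qed
  moreover have "\<exists>y. \<beta> (jmat 0 0 0 0 x 0) = jmat 0 0 0 0 y 0" for x
  proof -
    obtain a b c u v w where X: "\<beta> (jmat 0 0 0 0 x 0) = jmat a b c u v w" by (rule jmat_ex[OF jmat_in_JJ])
    show ?thesis
      using *[of 1 0 0 "jmat 0 0 0 0 x 0"] *[of 0 0 1 "jmat 0 0 0 0 x 0"]
      by (simp add: X jordan_jmat jmat_linear jmat_eq_iff jmat_in_JJ half)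
  qed
  moreover have "\<exists>y. \<beta> (jmat 0 0 0 0 0 x) = jmat 0 0 0 0 0 y" for x
  proof -
    obtain a b c u v w where X: "\<beta> (jmat 0 0 0 0 0 x) = jmat a b c u v w" by (rule jmat_ex[OF jmat_in_JJ])
    show ?thesis
      using *[of 1 0 0 "jmat 0 0 0 0 0 x"] *[of 0 1 0 "jmat 0 0 0 0 0 x"]
      by (simp add: X jordan_jmat jmat_linear jmat_eq_iff jmat_in_JJ half)
  qed
  ultimately show thesis using that by metis
qed

text \<open>The three component maps satisfy the triality relation
  \<open>f3 (ocnj (x * y)) = ocnj (f x * f2 y)\<close> and all fix 1. Setting one argument to 1
  identifies them, and the relation becomes multiplicativity.\<close>

lemma octonion_automorphism:
  assumes P: "\<beta> (jmat 0 0 0 0 0 1) = jmat 0 0 0 0 0 1"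
    and Q: "\<beta> (jmat 0 0 0 0 1 0) = jmat 0 0 0 0 1 0"
  obtains f where "linear f" "\<And>x y. f (x * y) = f x * f y" "f 1 = 1"
    "\<And>x y. inner (f x) (f y) = inner x y" "\<And>x. f (ogamma x) = ogamma (f x)"
    "\<And>a b c x y z. \<beta> (jmat a b c x y z) = jmat a b c (f x) (f y) (f z)"
proof -
  note diag = fixes_diagonal(1)[OF P Q]
  obtain f f2 f3 where f: "\<And>x. \<beta> (jmat 0 0 0 x 0 0) = jmat 0 0 0 (f x) 0 0"
    "\<And>x. \<beta> (jmat 0 0 0 0 x 0) = jmat 0 0 0 0 (f2 x) 0"
    "\<And>x. \<beta> (jmat 0 0 0 0 0 x) = jmat 0 0 0 0 0 (f3 x)"
    using peirce_components[OF diag] by blast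
  have one: "f 1 = 1" "f2 1 = 1" "f3 1 = 1"
    using f(1)[of 1] f(2)[of 1] f(3)[of 1] P Q fixes_diagonal(2)[OF P Q] by (simp_all add: jmat_eq_iff)
  have lin: "linear f"
  proof (rule linearI)
    show "f (x + y) = f x + f y" for x y
      using add[OF jmat_in_JJ jmat_in_JJ, of 0 0 0 x 0 0 0 0 0 y 0 0] by (simp add: jmat_linear jmat_eq_iff f)
    show "f (r *\<^sub>R x) = r *\<^sub>R f x" for r x
      using scaleR[OF jmat_in_JJ, of r 0 0 0 x 0 0] by (simp add: jmat_linear jmat_eq_iff f)
  qed
  have inn: "inner (f x) (f y) = inner x y" for x y
    using jordan[OF jmat_in_JJ jmat_in_JJ, of 0 0 0 x 0 0 0 0 0 y 0 0]
    by (simp add: jordan_jmat f diag jmat_eq_iff)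
  have prod3: "2 *\<^sub>R (jmat 0 0 0 x 0 0 \<circ>\<^sub>J jmat 0 0 0 0 y 0) = jmat 0 0 0 0 0 (ocnj (x * y))" for x y
    by (simp add: jordan_jmat jmat_linear jmat_eq_iff)
  have f3: "f3 (ocnj (x * y)) = ocnj (f x * f2 y)" for x y
  proof -
    have "\<beta> (jmat 0 0 0 0 0 (ocnj (x * y))) = jmat 0 0 0 0 0 (ocnj (f x * f2 y))"
      unfolding prod3[symmetric] by (simp only: scaleR JJ_jordan jordan jmat_in_JJ f)
    then show ?thesis by (simp add: f jmat_eq_iff)
  qed
  \<comment> \<open>By \<open>inn\<close> and \<open>f 1 = 1\<close>,
    \<open>inner (f x) 1 = inner x 1\<close>.\<close>
  have cnj: "f (ocnj x) = ocnj (f x)" for x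
    by (simp add: ocnj_eq_inner linear_diff[OF lin] linear_cmul[OF lin] one)
      (metis inn one(1))
  have "f2 x = f x" for x
    using f3[of x 1] f3[of 1 x] by (metis ocnj_simps(1) octonion_one one)
  then have f2: "f2 = f" by blast
  have "f3 x = f x" for x
    using f3[of "ocnj x" 1] by (simp add: one cnj)
  then have f3': "f3 = f" by blast
  have mult: "f (x * y) = f x * f y" for x y
    using f3[of x y] unfolding f2 f3' cnj by (metis ocnj_simps(1))
  have gam: "f (ogamma x) = ogamma (f x)" for x
    using jgamma[OF jmat_in_JJ, of 0 0 0 x 0 0] by (simp add: jgamma_jmat f jmat_eq_iff)
  have "\<beta> (jmat a b c x y z) = jmat a b c (f x) (f y) (f z)" for a b c x y z
  proof -
    have "jmat a b c x y z = jmat a b c 0 0 0 + jmat 0 0 0 x 0 0 + jmat 0 0 0 0 y 0 + jmat 0 0 0 0 0 z"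
      by (simp add: jmat_linear)
    then have "\<beta> (jmat a b c x y z) = jmat a b c 0 0 0 + jmat 0 0 0 (f x) 0 0 + jmat 0 0 0 0 (f y) 0 + jmat 0 0 0 0 0 (f z)"
      by (simp only: add JJ_add jmat_in_JJ diag f f2 f3')
    then show ?thesis by (simp add: jmat_linear)
  qed
  with lin mult one(1) inn gam show thesis by (rule that)
qed

end

text \<open>Commuting with \<open>ogamma\<close> preserves both summands. On quaternions
  \<open>f\<close> is conjugation by \<open>r\<close>; the element \<open>a e4\<close> is the
  product of \<open>a\<close> and \<open>e4\<close>, so the rest is determined by the image
  \<open>c e4\<close> of \<open>e4\<close>, where \<open>c\<close> has norm one by isometry.\<close>

lemma octonion_automorphism_form:
  assumes lin: "linear f" and mult: "\<And>x y. f (x * y) = f x * f y" and one: "f 1 = 1"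
    and inn: "\<And>x y. inner (f x) (f y) = inner x y" and gam: "\<And>x. f (ogamma x) = ogamma (f x)"
  obtains r c where "r * qcnj r = 1" "qcnj r * r = 1" "c * qcnj c = 1" "qcnj c * c = 1"
    "\<And>m a. f (Oct m a) = Oct (r * m * qcnj r) (c * r * a * qcnj r)"
proof -
  define f0 where "f0 m = hpart (f (Oct m 0))" for m
  have fh: "f (Oct m 0) = Oct (f0 m) 0" for m
    using gam[of "Oct m 0"] by (auto simp: ogamma_def octonion_eq_iff quat_eq_iff f0_def)
  have "linear f0"
  proof (rule linearI)
    show "f0 (x + y) = f0 x + f0 y" for x y
      using linear_add[OF lin, of "Oct x 0" "Oct y 0"] by (simp add: fh plus_octonion_def)
    show "f0 (r *\<^sub>R x) = r *\<^sub>R f0 x" for r x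
      using linear_cmul[OF lin, of r "Oct x 0"] by (simp add: fh scaleR_octonion_def)
  qed
  moreover have "f0 (x * y) = f0 x * f0 y" for x y
    using mult[of "Oct x 0" "Oct y 0"] by (simp add: fh times_octonion_def)
  moreover have "f0 1 = 1"
    using one by (simp add: fh one_octonion_def)
  ultimately obtain r where r: "r * qcnj r = 1" "qcnj r * r = 1" "\<And>x. f0 x = r * x * qcnj r"
    using quat_automorphism_inner by metis
  obtain c where c: "f (Oct 0 1) = Oct 0 c"
  proof -
    have "f (- Oct 0 1) = ogamma (f (Oct 0 1))"
      using gam[of "Oct 0 1"] by (simp add: ogamma_def uminus_octonion_def)
    then have "hpart (f (Oct 0 1)) = 0"
      by (simp add: linear_neg[OF lin] ogamma_def octonion_eq_iff quat_eq_iff)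
    then show thesis using that by (metis octonion.collapse)
  qed
  have "inner c c = 1"
    using inn[of "Oct 0 1" "Oct 0 1"] by (simp add: c inner_Oct inner_quat_def)
  then have cc: "c * qcnj c = 1" "qcnj c * c = 1"
    by (simp_all flip: quat_inner_self)
  have "f (Oct m a) = Oct (r * m * qcnj r) (c * r * a * qcnj r)" for m a
  proof -
    have "Oct m a = Oct m 0 + Oct a 0 * Oct 0 1"
      by (simp add: times_octonion_def plus_octonion_def)
    then have "f (Oct m a) = Oct (f0 m) 0 + Oct (f0 a) 0 * Oct 0 c"
      by (simp add: linear_add[OF lin] mult fh c)
    then show ?thesis
      by (simp add: times_octonion_def plus_octonion_def r(3) mult.assoc)
  qed
  with r(1,2) cc show thesis by (rule that)
qed

text \<open>There is no determinant over the quaternions; instead, left multiplication by a matrix is an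
  endomorphism of a finite-dimensional real space.\<close>

lemma Sp_one_sided:
  fixes A :: "quat^'n^'n"
  assumes "A ** madj A = mat 1"
  shows "A \<in> carrier Sp"
proof -
  have lin: "linear ((**) B)" for B :: "quat^'n^'n"
    by (rule linearI) (simp_all add: qmat_simps matrix_add_ldistrib)
  have "(**) A \<circ> (**) (madj A) = id"
    by (simp add: fun_eq_iff matrix_mul_assoc assms)
  then have "(**) (madj A) \<circ> (**) A = id"
    by (rule linear_inverse_left[OF lin lin, THEN iffD1])
  then have "madj A ** (A ** mat 1) = mat 1"
    unfolding fun_eq_iff comp_apply id_apply by blast
  then show ?thesis using assms by (simp add: Sp_simps)
qed

section \<open>Every centralizing automorphism lies in the image\<close>

lemma F4_sigma_gamma_mult: "\<alpha> \<otimes>\<^bsub>F4_sigma_gamma\<^esub> \<beta> = \<alpha> \<otimes>\<^bsub>F4\<^esub> \<beta>"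
  by (simp add: F4_sigma_gamma_def)

lemma Phi_surj:
  assumes \<beta>: "\<beta> \<in> carrier F4_sigma_gamma"
  shows "\<beta> \<in> Phi ` carrier Sp112"
proof -
  interpret Phi: group_hom Sp112 F4_sigma_gamma Phi by (rule Phi_group_hom)
  interpret centralizing \<beta> by unfold_locales (rule \<beta>)
  obtain c1 c2 d1 d2 where P: "\<beta> (jmat 0 0 0 0 0 1) = jmat 0 0 0 0 (Oct (qcnj c2) 0) (Oct c1 0)"
    and Q: "\<beta> (jmat 0 0 0 0 1 0) = jmat 0 0 0 0 (Oct (qcnj d2) 0) (Oct d1 0)"
    and cd: "c1 * qcnj c1 + c2 * qcnj c2 = 1" "d1 * qcnj d1 + d2 * qcnj d2 = 1"
      "d1 * qcnj c1 + d2 * qcnj c2 = 0"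
    by (rule unit_vectors_image)
  define C :: "quat^2^2" where "C = vector [vector [c1, c2], vector [d1, d2]]"
  have cd': "c1 * qcnj d1 + c2 * qcnj d2 = 0"
    using arg_cong[OF cd(3), of qcnj] by (simp add: qcnj_mult)
  have "C ** madj C = mat 1"
    by (simp add: vec_eq_iff forall_2 qmat_mult_nth sum_2 C_def mat_def cd cd')
  then have "C \<in> carrier Sp" by (rule Sp_one_sided)
  then have "madj C \<in> carrier Sp" by (simp add: Sp_simps)
  \<comment> \<open>For \<open>q = 1\<close> the first row is multiplied on the right by the adjoint
    of the Sp(2) block, so the block \<open>madj C\<close> sends the unit rows to the rows of
    \<open>C\<close>.\<close>
  define g where "g = (mat 1 :: quat^1^1, mat 1 :: quat^1^1, madj C)"
  have g: "g \<in> carrier Sp112"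
    using \<open>madj C \<in> carrier Sp\<close> by (simp add: g_def Sp112_simps Sp_simps)
  have gPQ: "Phi g (jmat 0 0 0 0 0 1) = \<beta> (jmat 0 0 0 0 0 1)" "Phi g (jmat 0 0 0 0 1 0) = \<beta> (jmat 0 0 0 0 1 0)"
    unfolding P Q g_def Phi_apply[OF jmat_in_JJ]
    by (simp_all add: phi_def vec_eq_iff forall_3 jmat_nth jcomb_nth qmat_mult_nth sum_3 sum_1
        blk_nth C_def mat_def erow_nth octonion_eq_iff ocnj_def)
  define \<gamma> where "\<gamma> = Phi (inv\<^bsub>Sp112\<^esub> g) \<otimes>\<^bsub>F4_sigma_gamma\<^esub> \<beta>"
  have \<gamma>: "\<gamma> \<in> carrier F4_sigma_gamma"
    using g \<beta> by (simp add: \<gamma>_def)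
  have \<gamma>_apply: "\<gamma> X = Phi (inv\<^bsub>Sp112\<^esub> g) (\<beta> X)" if "X \<in> JJ" for X
    using that g F4
    by (simp add: \<gamma>_def mult_F4 Phi_in_F4 compose_def F4_sigma_gamma_mult del: Phi.hom_inv)
  interpret \<gamma>: centralizing \<gamma> by unfold_locales (rule \<gamma>)
  have PQ: "\<gamma> (jmat 0 0 0 0 0 1) = jmat 0 0 0 0 0 1" "\<gamma> (jmat 0 0 0 0 1 0) = jmat 0 0 0 0 1 0"
    using g by (simp_all add: \<gamma>_apply jmat_in_JJ Phi_mult Phi_one del: Phi.hom_inv Phi.hom_one flip: gPQ)
  obtain f where f: "linear f" "\<And>x y. f (x * y) = f x * f y" "f 1 = 1"
    "\<And>x y. inner (f x) (f y) = inner x y" "\<And>x. f (ogamma x) = ogamma (f x)"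
    and \<gamma>f: "\<And>a b c x y z. \<gamma> (jmat a b c x y z) = jmat a b c (f x) (f y) (f z)"
    using \<gamma>.octonion_automorphism[OF PQ] by metis
  obtain r c where r: "r * qcnj r = 1" "qcnj r * r = 1" and c: "c * qcnj c = 1" "qcnj c * c = 1"
    and f_eq: "\<And>m a. f (Oct m a) = Oct (r * m * qcnj r) (c * r * a * qcnj r)"
    using octonion_automorphism_form[OF f] by metis
  have f_sel: "hpart (f x) = r * hpart x * qcnj r" "epart (f x) = c * r * epart x * qcnj r" for x
    using f_eq[of "hpart x" "epart x"] by simp_all
  \<comment> \<open>Conjugation by \<open>r E\<close> acts on quaternionic entries as
    \<open>f\<close> does, and the left factor \<open>c * r\<close> gives
    \<open>c * r * a * qcnj r\<close> on the \<open>e4\<close> components.\<close>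
  define h where "h = (mat (c * r) :: quat^1^1, mat r :: quat^1^1, mat r :: quat^2^2)"
  have cr: "c * r * (qcnj r * qcnj c) = 1" "qcnj r * qcnj c * (c * r) = 1"
    using r c by (metis mult.assoc mult.right_neutral)+
  have h: "h \<in> carrier Sp112"
    by (auto simp: h_def Sp112_simps Sp_simps vec_eq_iff forall_2 qmat_mult_nth sum_1 sum_2 mat_def r cr qcnj_mult)
  have "\<gamma> = Phi h"
  proof (rule extensionalityI)
    show "\<gamma> \<in> extensional JJ"
      using \<gamma>.F4 by (simp add: F4_set_def Bij_def)
    show "Phi h \<in> extensional JJ" by (simp add: h_def Phi_def)
    fix X assume X: "X \<in> JJ"
    then obtain a b c' x y z where X': "X = jmat a b c' x y z" using jmat_expand by metis
    show "\<gamma> X = Phi h X"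
      unfolding h_def Phi_apply[OF X] unfolding X' \<gamma>f
      by (simp add: f_sel vec_eq_iff forall_3 jmat_nth phi_def jcomb_nth qmat_mult_nth sum_3 sum_1
          blk_nth mat_def erow_nth octonion_eq_iff ocnj_def r qcnj_mult mult.assoc)
  qed
  then have "\<beta> = Phi (g \<otimes>\<^bsub>Sp112\<^esub> h)"
    using g h \<beta> by (metis Phi.H.inv_solve_left Phi.hom_closed Phi.hom_inv Phi.hom_mult \<gamma>_def)
  then show ?thesis using g h by blast
qed

section \<open>Topology\<close>

text \<open>The squared norm is the real trace of \<open>A ** madj A\<close>; this gives the
  boundedness needed for compactness.\<close>

lemma norm_le_sqrt_card_Sp:
  fixes A :: "quat^'n^'n"
  assumes "A \<in> carrier Sp"
  shows "norm A \<le> sqrt CARD('n)"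
proof -
  have "inner A A = rtr (A ** madj A)"
    by (simp add: inner_vec_def rtr_def qmat_mult_nth qre_sum inner_quat_def quat_sel_times qcnj_def)
  then have "inner A A = CARD('n)"
    using assms by (simp add: Sp_simps rtr_def mat_def)
  then show ?thesis by (simp add: norm_eq_sqrt_inner)
qed

lemma continuous_qmat_mult [continuous_intros]:
  fixes f :: "'a::topological_space \<Rightarrow> quat^'n^'m" and g :: "'a \<Rightarrow> quat^'k^'n"
  assumes "continuous_on S f" "continuous_on S g"
  shows "continuous_on S (\<lambda>x. f x ** g x)"
  unfolding matrix_matrix_mult_def by (intro continuous_intros assms)

lemma linear_madj: "linear (madj :: quat^'n^'m \<Rightarrow> quat^'m^'n)"
  by (rule linearI) simp_all

lemma compact_Sp: "compact (carrier Sp :: (quat^'n^'n) set)"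
proof -
  have "closed {A :: quat^'n^'n. A ** madj A = mat 1 \<and> madj A ** A = mat 1}"
    by (intro closed_Collect_conj closed_Collect_eq continuous_intros
        linear_continuous_on_compose[OF _ linear_madj])
  then show ?thesis
    unfolding compact_eq_bounded_closed bounded_iff Sp_def qadjoint_eq_madj
    using norm_le_sqrt_card_Sp by (auto simp: Sp_simps)
qed

lemma compact_Sp112: "compact (carrier Sp112)"
  unfolding Sp112_def by (simp add: compact_Times compact_Sp)

text \<open>The topology on maps is that of pointwise convergence, so it suffices to evaluate at a
  fixed \<open>X\<close>; outside \<open>JJ\<close> the value does not depend on
  \<open>g\<close>.\<close>

lemma continuous_Phi: "continuous_on S (\<lambda>g. Phi g X)"
proof (cases "X \<in> JJ")
  case True
  have j: "linear (\<lambda>(M, a). jcomb M a)"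
    by (rule linearI) (auto simp: jcomb_add jcomb_scaleR)
  have b: "linear (\<lambda>(q, B). blk q B)"
    by (rule linearI) (auto simp: vec_eq_iff forall_3 blk_nth)
  have *: "continuous_on S (\<lambda>g::(quat^1^1) \<times> (quat^1^1) \<times> (quat^2^2). blk (fst (snd g)) (snd (snd g)))"
    using linear_continuous_on_compose[OF _ b, of S snd] by (simp add: case_prod_beta continuous_intros)
  have **: "continuous_on S (\<lambda>g. (\<lambda>(M, a). jcomb M a)
     (blk (fst (snd g)) (snd (snd g)) ** hmat X ** madj (blk (fst (snd g)) (snd (snd g))),
      fst g ** erow X ** madj (blk (fst (snd g)) (snd (snd g)))))"
    by (intro linear_continuous_on_compose[OF _ j] continuous_intros *
         linear_continuous_on_compose[OF _ linear_madj])
  show ?thesis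
    using ** True by (simp add: Phi_def case_prod_beta phi_def)
qed (simp add: Phi_def case_prod_beta)

lemma continuous_map_Phi:
  "continuous_map (top_of_set (carrier Sp112)) topology_JJ_maps Phi"
  unfolding topology_JJ_maps_def continuous_map_componentwise
proof (intro conjI ballI)
  show "Phi ` topspace (top_of_set (carrier Sp112)) \<subseteq> extensional JJ"
    by (auto simp: Phi_def)
  show "continuous_map (top_of_set (carrier Sp112)) (top_of_set JJ) (\<lambda>x. Phi x X)" if "X \<in> JJ" for X
    using that by (auto simp: continuous_map_in_subtopology continuous_Phi Phi_in_JJ)
qed

theorem theorem1p3:
  shows "lie_isomorphic
    F4_sigma_gamma (subtopology topology_JJ_maps (carrier F4_sigma_gamma))
    (Sp112 Mod Z2) Sp112_quotient_topology"
proof -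
  let ?T = "subtopology topology_JJ_maps (carrier F4_sigma_gamma)"
  let ?h = "\<lambda>X. the_elem (Phi ` X)"
  let ?q = "\<lambda>x. Z2 #>\<^bsub>Sp112\<^esub> x"
  interpret Phi: group_hom Sp112 F4_sigma_gamma Phi by (rule Phi_group_hom)
  interpret Z2: normal Z2 Sp112 by (rule normal_Z2)
  have surj: "Phi ` carrier Sp112 = carrier F4_sigma_gamma"
    using Phi_surj Phi.hom_closed by blast
  have iso: "?h \<in> iso (Sp112 Mod Z2) F4_sigma_gamma"
    using Phi.FactGroup_iso_set[OF surj] by (simp add: kernel_Phi)
  have carrier: "carrier (Sp112 Mod Z2) = ?q ` carrier Sp112"
    by (auto simp: FactGroup_def RCOSETS_def)
  \<comment> \<open>Elements of a coset differ by the kernel, so the image of the coset under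
    \<open>Phi\<close> is a singleton.\<close>
  have hq: "?h (?q g) = Phi g" if "g \<in> carrier Sp112" for g
  proof -
    have "Phi ` (?q g) = {Phi g}"
      using that Phi.G.one_closed by (auto simp: r_coset_def simp flip: kernel_Phi) (force simp: kernel_def)+
    then show ?thesis by simp
  qed
  have quot: "quotient_map (top_of_set (carrier Sp112)) Sp112_quotient_topology ?q"
    unfolding Sp112_quotient_topology_def by (rule quotient_map_quotient_topology)
  have "continuous_map (top_of_set (carrier Sp112)) ?T Phi"
    using continuous_map_Phi by (simp add: continuous_map_in_subtopology surj)
  then have "continuous_map (top_of_set (carrier Sp112)) ?T (?h \<circ> ?q)"
    by (rule continuous_map_eq) (simp add: hq)
  then have cont: "continuous_map Sp112_quotient_topology ?T ?h"
    by (rule continuous_compose_quotient_map[OF quot])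
  have top_quot: "topspace Sp112_quotient_topology = carrier (Sp112 Mod Z2)"
    by (simp add: Sp112_quotient_topology_def carrier)
  have "compact_space (top_of_set (carrier Sp112))"
    using compact_Sp112 by (simp add: compact_space_subtopology)
  then have comp: "compact_space Sp112_quotient_topology"
    using image_compactin[OF _ quotient_imp_continuous_map[OF quot]]
      quotient_imp_surjective_map[OF quot]
    unfolding compact_space_def by metis
  have "Hausdorff_space topology_JJ_maps"
    unfolding topology_JJ_maps_def by (simp add: Hausdorff_space_product_topology Hausdorff_space_subtopology)
  then have haus: "Hausdorff_space ?T" by (rule Hausdorff_space_subtopology)
  have "carrier F4_sigma_gamma \<subseteq> topspace topology_JJ_maps"
    using continuous_map_image_subset_topspace[OF continuous_map_Phi] by (simp add: surj)
  then have top_F4: "topspace ?T = carrier F4_sigma_gamma" by auto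
  have bij: "bij_betw ?h (carrier (Sp112 Mod Z2)) (carrier F4_sigma_gamma)"
    using iso by (simp add: iso_def)
  have "?h ` topspace Sp112_quotient_topology = topspace ?T" "inj_on ?h (topspace Sp112_quotient_topology)"
    using bij unfolding bij_betw_def top_quot top_F4 by blast+
  then have "homeomorphic_map Sp112_quotient_topology ?T ?h"
    by (rule continuous_imp_homeomorphic_map[OF cont comp haus])
  then obtain k where k: "homeomorphic_maps Sp112_quotient_topology ?T ?h k"
    unfolding homeomorphic_map_maps by blast
  \<comment> \<open>The isomorphism is wanted from the automorphism group to the quotient, so
    \<open>?h\<close> is inverted; the group-theoretic inverse must be matched with the topological
    inverse \<open>k\<close>.\<close>
  let ?i = "inv_into (carrier (Sp112 Mod Z2)) ?h"
  have "?i \<in> iso F4_sigma_gamma (Sp112 Mod Z2)"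
    by (rule group.iso_set_sym[OF Z2.factorgroup_is_group iso])
  moreover have "homeomorphic_map ?T Sp112_quotient_topology ?i"
  proof (rule homeomorphic_map_eq)
    show "homeomorphic_map ?T Sp112_quotient_topology k"
      using k homeomorphic_maps_sym homeomorphic_map_maps by blast
    show "k x = ?i x" if "x \<in> topspace ?T" for x
    proof -
      have kx: "k x \<in> carrier (Sp112 Mod Z2)" "?h (k x) = x"
        using k that unfolding homeomorphic_maps_def continuous_map_def by (auto simp: top_quot)
      show ?thesis
        using bij_betw_inv_into_left[OF bij kx(1)] unfolding kx(2) by (rule sym)
    qed
  qed
  ultimately show ?thesis unfolding lie_isomorphic_def by blast
qed

end
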